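(* For $p,q\in\mathbb{N}$, $$\begin{aligned}&3\Bigl\{\zeta_2((p,q,s);PU(3))+(-1)^{p}\zeta_2((p,s,q);PU(3))+(-1)^q\zeta_2((q,s,p);PU(3))\Bigr\}\\ &=-\sum_{\tau=0}^{p}\binom{p+q-\tau-1}{q-1}(-1)^{\tau}\frac{(2\pi i)^{\tau}}{\tau!}\sum_{a=0}^{2}B_{\tau}\Bigl(\frac{a}{3}\Bigr)\phi(s+p+q-\tau,-a/3)\\ &\quad-\sum_{\tau=0}^{q}\binom{p+q-\tau-1}{p-1}\frac{(2\pi i)^{\tau}}{\tau!}\sum_{a=0}^{2}B_{\tau}\Bigl(\frac{a}{3}\Bigr)\phi(s+p+q-\tau,a/3)\end{aligned}$$ holds for $s\in\mathbb{C}$ except for singularities of the functions on both sides.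
   Context: For $(s_1,s_2,s_3)\in\mathbb{C}^3$, $\zeta_2((s_1,s_2,s_3);PU(3))=\sum_{m,n\ge1,\ m\equiv n\ (\mathrm{mod}\ 3)}\frac{1}{m^{s_1}n^{s_2}(m+n)^{s_3}}$ (the zeta-function of the weight lattice of the projective unitary group $PU(3)$, i.e. of the root lattice of type $A_2$), understood via its meromorphic continuation to $\mathbb{C}^3$. $\phi(s,\alpha)=\sum_{m\ge1}e^{2\pi i m\alpha}m^{-s}$ is the Lerch zeta-function (meromorphically continued in $s$; for $\alpha\in\mathbb{Z}$ it is $\zeta(s)$). $B_\tau(x)$ are the Bernoulli polynomials, $te^{xt}/(e^t-1)=\sum_\tau B_\tau(x)t^\tau/\tau!$. *)

theory Defs
  imports "HOL-Complex_Analysis.Complex_Analysis"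
begin

section \<open>Meromorphic functions of several complex variables\<close>

text \<open>
  Holomorphy on \<^emph>\<open>open\<close> subsets of \<open>\<complex>\<^sup>n\<close>: Frechet differentiability
  with a complex-linear derivative.
\<close>

definition holomorphic_Cn_on :: "(complex ^ 'n \<Rightarrow> complex) \<Rightarrow> (complex ^ 'n) set \<Rightarrow> bool"
    (infixl \<open>holomorphic'_Cn'_on\<close> 50) where
  "f holomorphic_Cn_on U \<longleftrightarrow>
     (\<forall>w\<in>U. \<exists>a :: complex ^ 'n. (f has_derivative (\<lambda>h. \<Sum>i\<in>UNIV. a $ i * h $ i)) (at w))"

text \<open>
  A meromorphic function on \<open>\<complex>\<^sup>n\<close> is a function \<open>F\<close> together with a nowhere dense
  hypersurface \<open>S\<close> such that locally \<open>S = {h = 0}\<close> and \<open>F = g / h\<close> off \<open>S\<close>, with \<open>g\<close>, \<open>h\<close>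
  holomorphic. The values of \<open>F\<close> on \<open>S\<close> are irrelevant, and \<open>S\<close> need not be minimal.
\<close>

definition meromorphic_Cn :: "(complex ^ 'n \<Rightarrow> complex) \<Rightarrow> (complex ^ 'n) set \<Rightarrow> bool" where
  "meromorphic_Cn F S \<longleftrightarrow>
     interior S = {} \<and>
     (\<forall>w. \<exists>U g h. open U \<and> w \<in> U \<and> g holomorphic_Cn_on U \<and> h holomorphic_Cn_on U \<and>
        S \<inter> U = {z \<in> U. h z = 0} \<and> (\<forall>z\<in>U - S. F z = g z / h z))"

definition meromorphic_continuation_Cn ::
    "(complex ^ 'n \<Rightarrow> complex) \<Rightarrow> (complex ^ 'n) set \<Rightarrow>
     (complex ^ 'n \<Rightarrow> complex) \<Rightarrow> (complex ^ 'n) set \<Rightarrow> bool" where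
  "meromorphic_continuation_Cn f D F S \<longleftrightarrow>
     meromorphic_Cn F S \<and> (\<forall>w\<in>D - S. F w = f w)"

text \<open>
  The singularities are the points lying in the exceptional set of every presentation \<open>(F, S)\<close>
  of the continuation; at all other points the continuation has a well-defined value
  whenever \<open>D\<close> has nonempty interior.
\<close>

definition singularities_Cn ::
    "(complex ^ 'n \<Rightarrow> complex) \<Rightarrow> (complex ^ 'n) set \<Rightarrow> (complex ^ 'n) set" where
  "singularities_Cn f D = {w. \<forall>F S. meromorphic_continuation_Cn f D F S \<longrightarrow> w \<in> S}"

definition continued_value_Cn ::
    "(complex ^ 'n \<Rightarrow> complex) \<Rightarrow> (complex ^ 'n) set \<Rightarrow> complex ^ 'n \<Rightarrow> complex" where
  "continued_value_Cn f D w =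
     (THE v. \<exists>F S. meromorphic_continuation_Cn f D F S \<and> w \<notin> S \<and> v = F w)"


section \<open>The zeta-function of \<open>PU(3)\<close>\<close>

definition PU3_index :: "(nat \<times> nat) set" where
  "PU3_index = {(m, n). 1 \<le> m \<and> 1 \<le> n \<and> m mod 3 = n mod 3}"

definition PU3_term :: "complex ^ 3 \<Rightarrow> nat \<times> nat \<Rightarrow> complex" where
  "PU3_term s = (\<lambda>(m, n).
     1 / (of_nat m powr (s $ 1) * of_nat n powr (s $ 2) * of_nat (m + n) powr (s $ 3)))"

text \<open>For families of complex numbers, \<open>summable_on\<close> means absolute convergence.\<close>

definition zeta2_PU3_series :: "complex ^ 3 \<Rightarrow> complex" where
  "zeta2_PU3_series s = (\<Sum>\<^sub>\<infinity>mn\<in>PU3_index. PU3_term s mn)"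

definition zeta2_PU3_convergence :: "(complex ^ 3) set" where
  "zeta2_PU3_convergence = {s. PU3_term s summable_on PU3_index}"

definition zeta2_PU3 :: "complex ^ 3 \<Rightarrow> complex" where
  "zeta2_PU3 = continued_value_Cn zeta2_PU3_series zeta2_PU3_convergence"

definition zeta2_PU3_singularities :: "(complex ^ 3) set" where
  "zeta2_PU3_singularities = singularities_Cn zeta2_PU3_series zeta2_PU3_convergence"


section \<open>The Lerch zeta-function\<close>

definition lerch_series :: "complex \<Rightarrow> real \<Rightarrow> complex" where
  "lerch_series s \<alpha> =
     (\<Sum>\<^sub>\<infinity>m\<in>{1::nat..}. exp (2 * of_real pi * \<i> * of_nat m * of_real \<alpha>) * of_nat m powr (- s))"

definition lerch_continuation :: "real \<Rightarrow> (complex \<Rightarrow> complex) \<Rightarrow> bool" where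
  "lerch_continuation \<alpha> F \<longleftrightarrow>
     F meromorphic_on UNIV \<and> (\<forall>s. Re s > 1 \<longrightarrow> F s = lerch_series s \<alpha>)"

text \<open>
  A function that is \<open>meromorphic_on\<close> a set may have arbitrary values at isolated points;
  analyticity at \<open>s\<close> makes the value at \<open>s\<close> independent of the choice of \<open>F\<close>.
\<close>

definition lerch_phi :: "complex \<Rightarrow> real \<Rightarrow> complex" where
  "lerch_phi s \<alpha> = (THE v. \<exists>F. lerch_continuation \<alpha> F \<and> F analytic_on {s} \<and> v = F s)"

definition lerch_singularities :: "real \<Rightarrow> complex set" where
  "lerch_singularities \<alpha> = {s. \<forall>F. lerch_continuation \<alpha> F \<longrightarrow> \<not> F analytic_on {s}}"


section \<open>Bernoulli polynomials\<close>

definition bernoulli_poly :: "nat \<Rightarrow> complex \<Rightarrow> complex" where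
  "bernoulli_poly k x = fact k * fps_nth (fps_X * fps_exp x / (fps_exp 1 - 1)) k"

end

theory Submission
  imports Defs
begin

text \<open>
  For \<open>Re s > 2\<close> all series converge absolutely. Collecting the terms with \<open>l\<^sup>-\<^sup>s\<close>, where \<open>l = m + n\<close> in the
  first zeta value and \<open>l = n\<close> in the other two, merges the three sums into the single sum of
  \<open>1 / (m\<^sup>p (l - m)\<^sup>q)\<close> over all integers \<open>m \<noteq> 0, l\<close> with \<open>m \<equiv> -l (mod 3)\<close>. Partial fractions reduce
  it to the symmetric sums of \<open>m\<^sup>-\<^sup>j\<close> over residue classes modulo 3. Their generating function is a
  cotangent, that is \<open>1 / (e\<^sup>t\<^sup>/\<^sup>3 \<omega> - 1)\<close> with \<open>\<omega>\<^sup>3 = 1\<close>, which is the generating function of the twisted sums of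
  \<open>B\<^sub>\<tau>(a/3)\<close>. The terms \<open>\<tau> = 0\<close> account for the omitted \<open>m = 0, l\<close>, and the contributions of
  \<open>B\<^sub>1(0) = -1/2\<close> to the two sums cancel.

  The values at a nonsingular point are reached along a complex line: the restriction of a
  presentation \<open>(F, S)\<close> to a line not contained in \<open>S\<close> is a meromorphic function of one variable, so the
  one-dimensional identity theorem both makes the continued values unambiguous and extends the relation.
\<close>

section \<open>Continuation along complex lines\<close>

text \<open>Identity theorem on the connected plane: a meromorphic function is either zero or
  nonzero off a sparse set, and vanishing around \<open>x\<close> excludes the latter. Analyticity
  at \<open>s\<close>, however far from \<open>x\<close>, carries the vanishing from a punctured
  neighbourhood to \<open>s\<close> itself.\<close>

lemma meromorphic_on_UNIV_eq_0:
  assumes "f meromorphic_on UNIV" and "f analytic_on {s}"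
    and "eventually (\<lambda>z. f z = 0) (at x)"
  shows "f s = 0"
proof -
  have "\<not> eventually (\<lambda>z. f z \<noteq> 0) (cosparse UNIV)"
  proof
    assume "eventually (\<lambda>z. f z \<noteq> 0) (cosparse UNIV)"
    then have "eventually (\<lambda>z. f z \<noteq> 0) (at x)"
      by (rule eventually_cosparse_imp_eventually_at) auto
    with assms(3) have "eventually (\<lambda>z. False) (at x)"
      by eventually_elim auto
    then show False by simp
  qed
  then have "eventually (\<lambda>z. f z = 0) (cosparse UNIV)"
    using meromorphic_imp_constant_or_avoid[OF assms(1), of 0] by auto
  then have "eventually (\<lambda>z. f z = 0) (at s)"
    by (rule eventually_cosparse_imp_eventually_at) auto
  then have "f \<midarrow>s\<rightarrow> 0" by (rule tendsto_eventually)
  moreover have "f \<midarrow>s\<rightarrow> f s"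
    using analytic_at_imp_isCont[OF assms(2)] by (simp add: isCont_def)
  ultimately show ?thesis using LIM_unique by blast
qed

text \<open>Chain rule: along the direction \<open>e\<close>, the complex-linear derivative with
  coefficients \<open>a\<close> becomes multiplication by the single number
  \<open>\<Sum>i\<in>UNIV. a $ i * e $ i\<close>.\<close>

lemma holomorphic_Cn_on_line:
  fixes \<iota> :: "complex \<Rightarrow> complex ^ 'n"
  assumes h: "h holomorphic_Cn_on U" and U: "open U"
    and \<iota>: "\<And>t. (\<iota> has_derivative (\<lambda>k. k *s e)) (at t)"
  shows "open (\<iota> -` U)" and "(\<lambda>t. h (\<iota> t)) holomorphic_on (\<iota> -` U)"
proof -
  have cont: "continuous_on UNIV \<iota>"
    using \<iota> by (meson continuous_at_imp_continuous_on has_derivative_continuous)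
  show op: "open (\<iota> -` U)"
    by (rule open_vimage[OF U cont])
  have "\<exists>D. ((\<lambda>t. h (\<iota> t)) has_field_derivative D) (at t)" if t: "t \<in> \<iota> -` U" for t
  proof -
    obtain a where a: "(h has_derivative (\<lambda>k. \<Sum>i\<in>UNIV. a $ i * k $ i)) (at (\<iota> t))"
      using h t unfolding holomorphic_Cn_on_def by auto
    have "((\<lambda>t. h (\<iota> t)) has_derivative (\<lambda>k. \<Sum>i\<in>UNIV. a $ i * (k *s e) $ i)) (at t)"
      by (rule has_derivative_compose[OF \<iota> a])
    also have "(\<lambda>k. \<Sum>i\<in>UNIV. a $ i * (k *s e) $ i) = (*) (\<Sum>i\<in>UNIV. a $ i * e $ i)"
      by (auto simp: sum_distrib_left sum_distrib_right mult_ac)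
    finally show ?thesis unfolding has_field_derivative_def by blast
  qed
  then show "(\<lambda>t. h (\<iota> t)) holomorphic_on (\<iota> -` U)"
    using op by (auto simp: holomorphic_on_def field_differentiable_def intro: has_field_derivative_at_within)
qed

text \<open>A whole line may lie inside \<open>S\<close>, where the local quotients say nothing
  about \<open>F\<close>. One point \<open>\<iota> s\<close> off \<open>S\<close> excludes this: by
  connectedness of the plane the line then meets \<open>S\<close> in isolated points only, so no
  local denominator vanishes identically along it.\<close>

lemma meromorphic_Cn_on_line:
  fixes \<iota> :: "complex \<Rightarrow> complex ^ 'n"
  assumes F: "meromorphic_Cn F S"
    and \<iota>: "\<And>t. (\<iota> has_derivative (\<lambda>k. k *s e)) (at t)"
    and s: "\<iota> s \<notin> S"
  shows "(\<lambda>t. F (\<iota> t)) meromorphic_on UNIV" and "(\<lambda>t. F (\<iota> t)) analytic_on {s}"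
    and "eventually (\<lambda>t. \<iota> t \<notin> S) (at x)"
proof -
  have loc: "\<exists>V g h. open V \<and> t \<in> V \<and> g holomorphic_on V \<and> h holomorphic_on V \<and>
      (\<forall>z\<in>V. \<iota> z \<in> S \<longleftrightarrow> h z = 0) \<and> (\<forall>z\<in>V. \<iota> z \<notin> S \<longrightarrow> F (\<iota> z) = g z / h z)" for t
  proof -
    obtain U g h where U: "open U" "\<iota> t \<in> U" and gh: "g holomorphic_Cn_on U" "h holomorphic_Cn_on U"
      and S: "S \<inter> U = {z \<in> U. h z = 0}" and Fgh: "\<forall>z\<in>U - S. F z = g z / h z"
      using F unfolding meromorphic_Cn_def by blast
    show ?thesis
      using holomorphic_Cn_on_line[OF gh(1) U(1) \<iota>] holomorphic_Cn_on_line[OF gh(2) U(1) \<iota>] U S Fgh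
      by (intro exI[of _ "\<iota> -` U"] exI[of _ "\<lambda>t. g (\<iota> t)"] exI[of _ "\<lambda>t. h (\<iota> t)"]) auto
  qed
  \<comment> \<open>Locally \<open>S\<close> meets the line in all or in isolated points; both conditions are open.\<close>
  define A where "A = {t. eventually (\<lambda>z. \<iota> z \<notin> S) (at t)}"
  define B where "B = {t. eventually (\<lambda>z. \<iota> z \<in> S) (nhds t)}"
  have "open B"
    unfolding B_def open_subopen[of "Collect _"] by (auto simp: eventually_nhds)
  have "open A"
  proof (subst open_subopen, safe)
    fix t assume "t \<in> A"
    then obtain X where X: "open X" "t \<in> X" "\<forall>z\<in>X. z \<noteq> t \<longrightarrow> \<iota> z \<notin> S"
      unfolding A_def eventually_at_topological by auto
    have "X \<subseteq> A"
    proof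
      fix y assume "y \<in> X"
      show "y \<in> A"
      proof (cases "y = t")
        case False
        then have "open (X - {t})" "y \<in> X - {t}" using X \<open>y \<in> X\<close> by auto
        then show ?thesis using X unfolding A_def eventually_at_topological by blast
      qed (use \<open>t \<in> A\<close> in auto)
    qed
    then show "\<exists>T. open T \<and> t \<in> T \<and> T \<subseteq> A" using X by blast
  qed
  have "A \<union> B = UNIV"
  proof -
    have "t \<in> A \<union> B" for t
    proof -
      obtain V g h where V: "open V" "t \<in> V" "h holomorphic_on V" and S: "\<forall>z\<in>V. \<iota> z \<in> S \<longleftrightarrow> h z = 0"
        using loc by metis
      have an: "h analytic_on {t}" using V analytic_at by blast
      have evV: "eventually (\<lambda>z. z \<in> V) (nhds t)" using V by (simp add: eventually_nhds_in_open)
      show ?thesis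
      proof (cases "eventually (\<lambda>z. h z \<noteq> 0) (at t)")
        case True
        have "eventually (\<lambda>z. z \<in> V) (at t)"
          using evV eventually_nhds_conv_at by blast
        with True have "eventually (\<lambda>z. \<iota> z \<notin> S) (at t)"
          by eventually_elim (use S in auto)
        then show ?thesis by (simp add: A_def)
      next
        case False
        then have fr: "frequently (\<lambda>z. h z = 0) (at t)" by (simp add: frequently_def)
        \<comment> \<open>Zeros of an analytic function accumulating at \<open>t\<close> make it
          vanish on a punctured neighbourhood; continuity adds \<open>t\<close>, so the line lies in
          \<open>S\<close> near \<open>t\<close>.\<close>
        then have ev0: "eventually (\<lambda>z. h z = 0) (at t)"
          using not_essential_frequently_0_imp_eventually_0[OF isolated_singularity_at_analytic[OF an]
              not_essential_analytic[OF an]] by simp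
        then have "h \<midarrow>t\<rightarrow> 0" by (rule tendsto_eventually)
        moreover have "h \<midarrow>t\<rightarrow> h t"
          using analytic_at_imp_isCont[OF an] by (simp add: isCont_def)
        ultimately have "h t = 0" using LIM_unique by blast
        with ev0 have "eventually (\<lambda>z. h z = 0) (nhds t)"
          using eventually_nhds_conv_at by blast
        with evV have "eventually (\<lambda>z. \<iota> z \<in> S) (nhds t)"
          by eventually_elim (use S in auto)
        then show ?thesis by (simp add: B_def)
      qed
    qed
    then show ?thesis by blast
  qed
  moreover have "A \<inter> B = {}"
  proof -
    have False if "t \<in> A" "t \<in> B" for t
    proof -
      have "eventually (\<lambda>z. \<iota> z \<notin> S) (at t)" using that by (simp add: A_def)
      moreover have "eventually (\<lambda>z. \<iota> z \<in> S) (at t)"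
        using that eventually_nhds_conv_at by (auto simp: B_def)
      ultimately have "eventually (\<lambda>z. False) (at t)" by eventually_elim auto
      then show False by simp
    qed
    then show ?thesis by blast
  qed
  moreover have "s \<notin> B" using s by (auto simp: B_def dest: eventually_nhds_x_imp_x)
  \<comment> \<open>The plane is a disjoint union of the open sets \<open>A\<close> and
    \<open>B\<close>, and \<open>s\<close> lies outside \<open>B\<close>, so connectedness leaves
    \<open>B\<close> empty.\<close>
  ultimately have A: "A = UNIV"
    using connected_UNIV[where 'a=complex] \<open>open A\<close> \<open>open B\<close> unfolding connected_def by blast
  then show ev: "eventually (\<lambda>t. \<iota> t \<notin> S) (at x)" for x by (auto simp: A_def)
  show "(\<lambda>t. F (\<iota> t)) meromorphic_on UNIV"
  proof (rule meromorphic_on_meromorphic_at[THEN iffD2], safe)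
    fix t
    obtain V g h where V: "open V" "t \<in> V" "g holomorphic_on V" "h holomorphic_on V"
      and Fgh: "\<forall>z\<in>V. \<iota> z \<notin> S \<longrightarrow> F (\<iota> z) = g z / h z"
      using loc by metis
    have an: "g analytic_on {t}" "h analytic_on {t}" using V analytic_at by blast+
    have "eventually (\<lambda>z. z \<in> V) (at t)" using V by (intro eventually_at_in_open') auto
    with ev[of t] have "eventually (\<lambda>z. F (\<iota> z) = g z / h z) (at t)"
      by eventually_elim (use Fgh in auto)
    moreover have "(\<lambda>z. g z / h z) meromorphic_on {t}"
      using an by (intro meromorphic_intros analytic_on_imp_meromorphic_on)
    ultimately show "(\<lambda>t. F (\<iota> t)) meromorphic_on {t}"
      using meromorphic_on_cong[of "{t}" "\<lambda>t. F (\<iota> t)" "\<lambda>z. g z / h z" "{t}"] by simp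
  qed
  show "(\<lambda>t. F (\<iota> t)) analytic_on {s}"
  proof -
    obtain V g h where V: "open V" "s \<in> V" "g holomorphic_on V" "h holomorphic_on V"
      and S: "\<forall>z\<in>V. \<iota> z \<in> S \<longleftrightarrow> h z = 0"
      and Fgh: "\<forall>z\<in>V. \<iota> z \<notin> S \<longrightarrow> F (\<iota> z) = g z / h z"
      using loc by metis
    have an: "g analytic_on {s}" "h analytic_on {s}" using V analytic_at by blast+
    have "h s \<noteq> 0" using S V s by blast
    moreover have "h \<midarrow>s\<rightarrow> h s"
      using analytic_at_imp_isCont[OF an(2)] by (simp add: isCont_def)
    ultimately have "eventually (\<lambda>z. h z \<noteq> 0) (nhds s)"
      using tendsto_imp_eventually_ne[of h "h s" "at s" 0] eventually_nhds_conv_at by blast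
    moreover have "eventually (\<lambda>z. z \<in> V) (nhds s)" using V by (simp add: eventually_nhds_in_open)
    ultimately have "eventually (\<lambda>z. F (\<iota> z) = g z / h z) (nhds s)"
      by eventually_elim (use Fgh S in auto)
    moreover have "(\<lambda>z. g z / h z) analytic_on {s}"
      using an \<open>h s \<noteq> 0\<close> by (intro analytic_intros) auto
    ultimately show ?thesis by (subst analytic_at_cong[OF _ refl])
  qed
qed

text \<open>Two presentations whose exceptional sets avoid \<open>\<iota> s\<close> both agree with
  \<open>f\<close> along the line near \<open>x\<close>, hence with each other at \<open>s\<close>.
  This makes the description operator in \<open>continued_value_Cn\<close> well defined by
  one-variable arguments alone; \<open>G\<close> is the restriction of any such
  presentation.\<close>

lemma meromorphic_continuation_Cn_line_value:
  fixes \<iota> :: "complex \<Rightarrow> complex ^ 'n"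
  assumes \<iota>: "\<And>t. (\<iota> has_derivative (\<lambda>k. k *s e)) (at t)"
    and D: "eventually (\<lambda>t. \<iota> t \<in> D) (at x)"
    and s: "\<iota> s \<notin> singularities_Cn f D"
  obtains G where "G meromorphic_on UNIV" "G analytic_on {s}"
    "eventually (\<lambda>t. G t = f (\<iota> t)) (at x)" "continued_value_Cn f D (\<iota> s) = G s"
proof -
  have *: "(\<lambda>t. F (\<iota> t)) meromorphic_on UNIV" "(\<lambda>t. F (\<iota> t)) analytic_on {s}"
     "eventually (\<lambda>t. F (\<iota> t) = f (\<iota> t)) (at x)"
    if "meromorphic_continuation_Cn f D F S" "\<iota> s \<notin> S" for F S
  proof -
    have mero: "meromorphic_Cn F S" and eq: "\<forall>w\<in>D - S. F w = f w"
      using that unfolding meromorphic_continuation_Cn_def by auto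
    show "(\<lambda>t. F (\<iota> t)) meromorphic_on UNIV" "(\<lambda>t. F (\<iota> t)) analytic_on {s}"
      using meromorphic_Cn_on_line[OF mero \<iota> that(2)] by auto
    show "eventually (\<lambda>t. F (\<iota> t) = f (\<iota> t)) (at x)"
      using meromorphic_Cn_on_line(3)[OF mero \<iota> that(2)] D by eventually_elim (use eq in auto)
  qed
  obtain F S where FS: "meromorphic_continuation_Cn f D F S" "\<iota> s \<notin> S"
    using s unfolding singularities_Cn_def by auto
  have uniq: "F' (\<iota> s) = F (\<iota> s)" if "meromorphic_continuation_Cn f D F' S'" "\<iota> s \<notin> S'" for F' S'
  proof -
    have "(\<lambda>t. F' (\<iota> t) - F (\<iota> t)) s = 0"
    proof (rule meromorphic_on_UNIV_eq_0[where f = "\<lambda>t. F' (\<iota> t) - F (\<iota> t)"])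
      show "(\<lambda>t. F' (\<iota> t) - F (\<iota> t)) meromorphic_on UNIV"
        by (intro meromorphic_intros *(1)[OF FS] *(1)[OF that])
      show "(\<lambda>t. F' (\<iota> t) - F (\<iota> t)) analytic_on {s}"
        by (intro analytic_intros *(2)[OF FS] *(2)[OF that])
      show "eventually (\<lambda>t. F' (\<iota> t) - F (\<iota> t) = 0) (at x)"
        using *(3)[OF FS] *(3)[OF that] by eventually_elim auto
    qed
    then show ?thesis by simp
  qed
  have "continued_value_Cn f D (\<iota> s) = F (\<iota> s)"
    unfolding continued_value_Cn_def 
  proof (rule the_equality)
    show "\<exists>F' S. meromorphic_continuation_Cn f D F' S \<and> \<iota> s \<notin> S \<and> F (\<iota> s) = F' (\<iota> s)"
      using FS by blast
  qed (use uniq in metis)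
  with *[OF FS] show ?thesis by (intro that) auto
qed

text \<open>Any two continuations agree on the half-plane \<open>Re z > 1\<close>, in particular
  near the point 2, so the identity theorem makes their values at a common point of analyticity
  equal.\<close>

lemma lerch_phi_continuation:
  assumes "s \<notin> lerch_singularities \<alpha>"
  obtains F where "F meromorphic_on UNIV" "F analytic_on {s}"
    "\<And>z. Re z > 1 \<Longrightarrow> F z = lerch_series z \<alpha>" "lerch_phi s \<alpha> = F s"
proof -
  obtain F where F: "lerch_continuation \<alpha> F" "F analytic_on {s}"
    using assms unfolding lerch_singularities_def by auto
  have uniq: "G s = F s" if "lerch_continuation \<alpha> G" "G analytic_on {s}" for G
  proof -
    have "(\<lambda>t. G t - F t) s = 0"
    proof (rule meromorphic_on_UNIV_eq_0[where f = "\<lambda>t. G t - F t"])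
      show "(\<lambda>t. G t - F t) meromorphic_on UNIV"
        using F that by (intro meromorphic_intros) (auto simp: lerch_continuation_def)
      show "(\<lambda>t. G t - F t) analytic_on {s}"
        by (intro analytic_intros F that)
      have "eventually (\<lambda>t. t \<in> {t. Re t > 1}) (at 2)"
        by (intro eventually_at_in_open' open_halfspace_Re_gt) auto
      then show "eventually (\<lambda>t. G t - F t = 0) (at 2)"
        by eventually_elim (use F that in \<open>auto simp: lerch_continuation_def\<close>)
    qed
    then show ?thesis by simp
  qed
  have "lerch_phi s \<alpha> = F s"
    unfolding lerch_phi_def 
  proof (rule the_equality)
    show "\<exists>F'. lerch_continuation \<alpha> F' \<and> F' analytic_on {s} \<and> F s = F' s"
      using F by blast
  qed (use uniq in metis)
  with F show ?thesis by (intro that) (auto simp: lerch_continuation_def)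
qed

text \<open>These are the lines used later: \<open>s\<close> is the last coordinate in the first
  zeta value and the middle one in the other two.\<close>

lemma has_derivative_vector_3:
  shows "((\<lambda>t::complex. vector [a, b, t] :: complex ^ 3) has_derivative (\<lambda>k. k *s vector [0, 0, 1])) (at x)"
    and "((\<lambda>t::complex. vector [a, t, b] :: complex ^ 3) has_derivative (\<lambda>k. k *s vector [0, 1, 0])) (at x)"
proof -
  have *: "((\<lambda>t::complex. u + t *s e) has_derivative (\<lambda>k. k *s e)) (at x)" for u e :: "complex ^ 3"
  proof -
    have "linear (\<lambda>k::complex. k *s e)"
      by (auto intro!: linearI simp: vec_eq_iff algebra_simps)
    then have "bounded_linear (\<lambda>k::complex. k *s e)"
      by (simp add: linear_conv_bounded_linear)
    from bounded_linear_imp_has_derivative[OF this]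
    show ?thesis by (auto intro!: derivative_eq_intros)
  qed
  have "(\<lambda>t::complex. vector [a, b, t] :: complex ^ 3) = (\<lambda>t. vector [a, b, 0] + t *s vector [0, 0, 1])"
    "(\<lambda>t::complex. vector [a, t, b] :: complex ^ 3) = (\<lambda>t. vector [a, 0, b] + t *s vector [0, 1, 0])"
    by (auto simp: vec_eq_iff forall_3 vector_3)
  then show "((\<lambda>t::complex. vector [a, b, t] :: complex ^ 3) has_derivative (\<lambda>k. k *s vector [0, 0, 1])) (at x)"
    "((\<lambda>t::complex. vector [a, t, b] :: complex ^ 3) has_derivative (\<lambda>k. k *s vector [0, 1, 0])) (at x)"
    using * by simp_all
qed

section \<open>Power sums over arithmetic progressions and Bernoulli polynomials\<close>

text \<open>Logarithmic derivative of the reflection formula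
  \<open>Gamma z * Gamma (1 - z) = pi / sin (pi * z)\<close>: both sides are differentiated at
  \<open>w\<close> and the nonzero common value is cancelled.\<close>

lemma Digamma_reflection_complex:
  fixes w :: complex
  assumes w: "w \<notin> \<int>"
  shows "Digamma (1 - w) - Digamma w = of_real pi * cot (of_real pi * w)"
proof -
  have w1: "1 - w \<notin> \<int>"
    using w by (metis Ints_1 Ints_diff diff_diff_eq2 add_diff_cancel_left')
  have np: "w \<notin> \<int>\<^sub>\<le>\<^sub>0" "1 - w \<notin> \<int>\<^sub>\<le>\<^sub>0"
    using w w1 nonpos_Ints_Int by blast+
  have sin: "sin (of_real pi * w) \<noteq> 0"
    using w by (auto simp: sin_eq_0 Ints_def)
  define P where "P = complex_of_real pi"
  have P: "P \<noteq> 0" by (simp add: P_def)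
  have d1: "((\<lambda>z. Gamma z * Gamma (1 - z)) has_field_derivative
      (Gamma w * Digamma w * Gamma (1 - w) - Gamma w * (Gamma (1 - w) * Digamma (1 - w)))) (at w)"
    using np by (auto intro!: derivative_eq_intros simp: algebra_simps)
  have d2: "((\<lambda>z. P / sin (P * z)) has_field_derivative
      (- P * (P * cos (P * w)) / (sin (P * w) * sin (P * w)))) (at w)"
    using sin unfolding P_def by (auto intro!: derivative_eq_intros simp: field_simps)
  have "(\<lambda>z. Gamma z * Gamma (1 - z)) = (\<lambda>z. P / sin (P * z))"
    by (simp add: Gamma_reflection_complex P_def)
  with d1 d2 have eq: "Gamma w * Digamma w * Gamma (1 - w) - Gamma w * (Gamma (1 - w) * Digamma (1 - w)) =
       - P * (P * cos (P * w)) / (sin (P * w) * sin (P * w))"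
    using DERIV_unique by fastforce
  have "(Gamma w * Gamma (1 - w)) * (Digamma w - Digamma (1 - w)) =
      - P * (P * cos (P * w)) / (sin (P * w) * sin (P * w))"
    using eq by (simp add: algebra_simps)
  then have "(P / sin (P * w)) * (Digamma w - Digamma (1 - w)) = (P / sin (P * w)) * (- P * cos (P * w) / sin (P * w))"
    by (simp add: Gamma_reflection_complex P_def)
  then have "Digamma w - Digamma (1 - w) = - P * cos (P * w) / sin (P * w)"
    using P sin unfolding P_def mult_cancel_left by simp
  then show ?thesis by (simp add: P_def cot_def algebra_simps)
qed

text \<open>Pairing \<open>n\<close> with \<open>- (n + 1)\<close> leaves only the index
  \<open>N\<close> over and fits the ranges \<open>n < N\<close> of the digamma limits at
  \<open>w\<close> and \<open>1 - w\<close>.\<close>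

lemma sum_symmetric_int_interval:
  fixes f :: "int \<Rightarrow> 'a :: ab_group_add"
  shows "(\<Sum>k\<in>{-int N..int N}. f k) = f (int N) + (\<Sum>n<N. f (int n) + f (- int (Suc n)))"
proof (induction N)
  case (Suc N)
  have "{-int (Suc N)..int (Suc N)} = insert (int (Suc N)) (insert (- int (Suc N)) {-int N..int N})"
    by auto
  then show ?case using Suc by (simp add: algebra_simps)
qed simp

lemma sum_int_interval_uminus:
  "(\<Sum>k\<in>{-int N..int N}. f (- k)) = (\<Sum>k\<in>{-int N..int N}. f k)"
  by (rule sum.reindex_bij_witness[of _ uminus uminus]) auto

text \<open>The series is only conditionally convergent, hence the symmetric partial sums. They are
  the difference of the digamma limits at \<open>1 - w\<close> and \<open>w\<close>, in which the
  logarithms cancel, plus the unpaired term \<open>1 / (w + N)\<close>, which tends to 0.\<close>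

lemma cot_partial_fractions:
  fixes w :: complex
  assumes w: "w \<notin> \<int>"
  shows "(\<lambda>N. \<Sum>k\<in>{-int N..int N}. 1 / (w + of_int k)) \<longlonglongrightarrow> of_real pi * cot (of_real pi * w)"
proof -
  have nz: "w \<noteq> 0" "1 - w \<noteq> 0" using w by auto
  have "(\<lambda>N. (of_real (ln (real N)) - (\<Sum>n<N. inverse (1 - w + of_nat n))) -
      (of_real (ln (real N)) - (\<Sum>n<N. inverse (w + of_nat n)))) \<longlonglongrightarrow> Digamma (1 - w) - Digamma w"
    by (intro tendsto_diff Digamma_LIMSEQ nz)
  moreover have "(\<lambda>N. 1 / (w + of_nat N)) \<longlonglongrightarrow> 0"
    by (intro tendsto_divide_0[OF tendsto_const] tendsto_add_filterlim_at_infinity[OF tendsto_const]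
        tendsto_of_nat)
  ultimately have "(\<lambda>N. 1 / (w + of_nat N) + ((of_real (ln (real N)) - (\<Sum>n<N. inverse (1 - w + of_nat n))) -
      (of_real (ln (real N)) - (\<Sum>n<N. inverse (w + of_nat n))))) \<longlonglongrightarrow> 0 + (Digamma (1 - w) - Digamma w)"
    by (rule tendsto_add[rotated])
  moreover have "1 / (w + of_nat N) + ((of_real (ln (real N)) - (\<Sum>n<N. inverse (1 - w + of_nat n))) -
      (of_real (ln (real N)) - (\<Sum>n<N. inverse (w + of_nat n)))) = (\<Sum>k\<in>{-int N..int N}. 1 / (w + of_int k))" for N
  proof -
    have neg: "1 / (w + of_int (- int (Suc n))) = - inverse (1 - w + of_nat n)" for n
    proof -
      have "w + of_int (- int (Suc n)) = - (1 - w + of_nat n)" by simp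
      then show ?thesis by (simp only: inverse_eq_divide divide_minus_right)
    qed
    show ?thesis
      unfolding sum_symmetric_int_interval neg
      by (simp add: sum_subtractf inverse_eq_divide)
  qed
  ultimately show ?thesis
    using Digamma_reflection_complex[OF w] by simp
qed

text \<open>With \<open>E\<close> the exponential of \<open>\<i> * pi * w\<close>, the cotangent is
  \<open>\<i> * (E * E + 1) / (E * E - 1)\<close>; splitting off its constant part produces the
  summand \<open>pi * \<i>\<close>.\<close>

lemma exp_partial_fractions:
  fixes w :: complex
  assumes w: "w \<notin> \<int>"
  shows "exp (2 * of_real pi * \<i> * w) \<noteq> 1"
    and "(\<lambda>N. \<Sum>k\<in>{-int N..int N}. 1 / (w + of_int k)) \<longlonglongrightarrow>
          2 * of_real pi * \<i> / (exp (2 * of_real pi * \<i> * w) - 1) + of_real pi * \<i>"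
proof -
  define E where "E = exp (\<i> * (of_real pi * w))"
  have E: "E \<noteq> 0" by (simp add: E_def)
  have E2: "exp (2 * of_real pi * \<i> * w) = E * E"
    unfolding E_def by (simp flip: exp_add add: algebra_simps)
  have Em: "exp (- (\<i> * (of_real pi * w))) = 1 / E"
    by (simp add: E_def exp_minus inverse_eq_divide)
  have sin0: "sin (of_real pi * w) \<noteq> 0"
    using w by (auto simp: sin_eq_0 Ints_def)
  have sin: "sin (of_real pi * w) = (E - 1 / E) / (2 * \<i>)"
    unfolding sin_exp_eq Em[symmetric] by (simp add: E_def)
  have cos: "cos (of_real pi * w) = (E + 1 / E) / 2"
    unfolding cos_exp_eq Em[symmetric] by (simp add: E_def)
  have ne: "E * E \<noteq> 1"
    using sin0 E unfolding sin by (auto simp: field_simps)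
  show "exp (2 * of_real pi * \<i> * w) \<noteq> 1"
    using ne by (simp add: E2)
  have "E * E - 1 \<noteq> 0" "E - 1 / E = (E * E - 1) / E" "E + 1 / E = (E * E + 1) / E"
    using ne E by (auto simp: field_simps)
  then have "of_real pi * cot (of_real pi * w) = 2 * of_real pi * \<i> / (E * E - 1) + of_real pi * \<i>"
    unfolding cot_def sin cos using E by (simp add: field_simps)
  with cot_partial_fractions[OF w]
  show "(\<lambda>N. \<Sum>k\<in>{-int N..int N}. 1 / (w + of_int k)) \<longlonglongrightarrow>
          2 * of_real pi * \<i> / (exp (2 * of_real pi * \<i> * w) - 1) + of_real pi * \<i>"
    by (simp add: E2)
qed

section \<open>Unconditional sums over the integers\<close>

text \<open>Every finite set of integers lies in all large symmetric intervals. Unconditional sums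
  can thus be compared with sums that converge only in symmetric order.\<close>

lemma has_sum_int_imp_tendsto_symmetric:
  assumes "(f has_sum S) (UNIV :: int set)"
  shows "(\<lambda>N. \<Sum>k\<in>{-int N..int N}. f k) \<longlonglongrightarrow> S"
proof -
  have "filterlim (\<lambda>N. {-int N..int N}) (finite_subsets_at_top UNIV) sequentially"
  proof (subst filterlim_finite_subsets_at_top, intro allI impI conjI)
    fix X :: "int set" assume X: "finite X \<and> X \<subseteq> UNIV"
    define M where "M = Max (insert 0 ((\<lambda>x. nat \<bar>x\<bar>) ` X))"
    have M: "nat \<bar>x\<bar> \<le> M" if "x \<in> X" for x
      unfolding M_def using X that by (intro Max_ge) auto
    show "\<forall>\<^sub>F N in sequentially. finite {-int N..int N} \<and> X \<subseteq> {-int N..int N} \<and> {-int N..int N} \<subseteq> UNIV"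
      using eventually_ge_at_top[of M]
    proof eventually_elim
      case (elim N)
      have "x \<in> {-int N..int N}" if "x \<in> X" for x
        using M[OF that] elim by auto
      then show ?case by auto
    qed
  qed
  then show ?thesis
    using assms unfolding has_sum_def by (rule filterlim_compose[rotated])
qed

lemma summable_on_norm_bound:
  fixes f :: "'a \<Rightarrow> 'b :: banach"
  assumes "g summable_on A" and "\<And>x. x \<in> A \<Longrightarrow> norm (f x) \<le> g x"
  shows "f summable_on A"
proof -
  have "(\<lambda>x. norm (f x)) summable_on A"
    by (rule Infinite_Sum.summable_on_comparison_test[OF assms]) auto
  then show ?thesis by (rule Infinite_Sum.abs_summable_summable)
qed

lemma summable_on_int:
  fixes f :: "int \<Rightarrow> 'a :: banach"
  assumes "(\<lambda>n. f (int n)) summable_on UNIV" "(\<lambda>n. f (- int n)) summable_on UNIV"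
  shows "f summable_on UNIV"
proof -
  have "f summable_on range int"
    using assms(1) by (subst summable_on_reindex) (auto simp: o_def inj_on_def)
  \<comment> \<open>Starting at 1 keeps the two halves disjoint at 0.\<close>
  moreover have "(\<lambda>n. f (- int n)) summable_on {1..}"
    using assms(2) by (rule summable_on_subset_banach) auto
  then have "f summable_on (\<lambda>n. - int n) ` {1..}"
    by (subst summable_on_reindex) (auto simp: o_def inj_on_def)
  ultimately have "f summable_on (range int \<union> (\<lambda>n. - int n) ` {1..})"
    by (rule summable_on_Un_disjoint) auto
  moreover have "x \<in> range int \<union> (\<lambda>n. - int n) ` {1..}" for x :: int
    by (cases x rule: int_cases) (auto intro!: image_eqI[of _ _ "Suc _"])
  then have "range int \<union> (\<lambda>n. - int n) ` {1..} = UNIV" by blast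
  ultimately show ?thesis by simp
qed

lemma summable_on_inverse_squares_nat: "(\<lambda>n::nat. 1 / (real n)\<^sup>2) summable_on UNIV"
  by (intro norm_summable_imp_summable_on) (use inverse_power_summable[of 2, where 'a=real] in \<open>simp add: inverse_eq_divide\<close>)

lemma summable_on_inverse_squares_progression:
  "(\<lambda>k::int. 1 / (real_of_int (c + 3 * k))\<^sup>2) summable_on UNIV"
proof -
  have "(\<lambda>m::int. 1 / (real_of_int m)\<^sup>2) summable_on UNIV"
    using summable_on_inverse_squares_nat by (intro summable_on_int) auto
  then have "(\<lambda>m::int. 1 / (real_of_int m)\<^sup>2) summable_on range (\<lambda>k. c + 3 * k)"
    by (rule summable_on_subset_banach) auto
  then show ?thesis
    by (subst (asm) summable_on_reindex) (auto simp: o_def inj_on_def)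
qed

section \<open>Generating functions of the twisted Bernoulli sums\<close>

text \<open>A discrete Fourier transform modulo 3 of the values \<open>B_j(a/3)\<close>, scaled by
  \<open>(2 pi i)^j / j!\<close>. It depends only on the class of \<open>c\<close> modulo 3, so
  \<open>2 * l\<close> can stand for \<open>- l\<close>.\<close>

definition bernoulli_twist :: "nat \<Rightarrow> int \<Rightarrow> complex" where
  "bernoulli_twist j c = (2 * of_real pi * \<i>) ^ j / fact j *
     (\<Sum>a = 0..2. bernoulli_poly j (of_nat a / 3) * exp (- (2 * of_real pi * \<i> * of_nat a * of_int c / 3)))"

text \<open>Put \<open>u = v * exp (t / 3)\<close> with \<open>v ^ 3 = 1\<close>. The twisted sum of
  the three Bernoulli generating functions is \<open>t * (1 + u + u^2) / (u^3 - 1)\<close>, which is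
  \<open>t / (u - 1)\<close>; finally \<open>t\<close> is scaled by \<open>2 pi i\<close>.\<close>

lemma bernoulli_twist_fps:
  defines "E \<equiv> \<lambda>c. fps_const (exp (- (2 * of_real pi * \<i> * of_int c / 3))) * fps_exp (2 * of_real pi * \<i> / 3) - 1"
  shows "E c * Abs_fps (\<lambda>j. bernoulli_twist j c) = fps_const (2 * of_real pi * \<i>) * fps_X"
proof -
  define \<pi>2 where "\<pi>2 = 2 * of_real pi * \<i>"
  define v where "v = exp (- (2 * of_real pi * \<i> * of_int c / 3))"
  define u where "u = fps_const v * fps_exp (1 / 3 :: complex)"
  define d where "d = (fps_exp 1 - 1 :: complex fps)"
  define b where "b = (\<lambda>x::complex. fps_X * fps_exp x / d)"
  have v3: "v ^ 3 = 1"
  proof -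
    have "v ^ 3 = exp (of_nat 3 * (- (2 * of_real pi * \<i> * of_int c / 3)))"
      unfolding v_def by (rule exp_of_nat_mult[symmetric])
    also have "of_nat 3 * (- (2 * of_real pi * \<i> * of_int c / 3)) = of_int (2 * (- c)) * (of_real pi * \<i>)"
      by (simp add: field_simps)
    also have "exp \<dots> = 1"
      by (subst exp_eq_1) (auto intro!: exI[of _ "- c"])
    finally show ?thesis .
  qed
  have va: "exp (- (2 * of_real pi * \<i> * of_nat a * of_int c / 3)) = v ^ a" for a
  proof -
    have "- (2 * of_real pi * \<i> * of_nat a * of_int c / 3) = of_nat a * (- (2 * of_real pi * \<i> * of_int c / 3))"
      by (simp add: field_simps)
    then show ?thesis unfolding v_def by (simp only: exp_of_nat_mult)
  qed
  have d1: "d $ 1 = 1" "d $ 0 = 0" by (simp_all add: d_def)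
  have d0: "d \<noteq> 0" using d1 by auto
  have subd: "subdegree d = 1" using d1 by (intro subdegreeI) auto
  \<comment> \<open>The division is exact, because \<open>d\<close> has subdegree 1 and the
    numerator contains the factor \<open>fps_X\<close>.\<close>
  have bd: "b x * d = fps_X * fps_exp x" for x
  proof -
    have "d dvd fps_X * fps_exp x"
      using subd d0 by (simp add: fps_dvd_iff)
    then show ?thesis by (simp add: b_def)
  qed
  define T where "T = b 0 + fps_const v * b (1/3) + fps_const (v\<^sup>2) * b (2/3)"
  have "(u - 1) * T * d = fps_X * ((u - 1) * (1 + u + u\<^sup>2))"
  proof -
    have "T * d = fps_X * (1 + u + u\<^sup>2)"
    proof -
      have "T * d = b 0 * d + fps_const v * (b (1/3) * d) + fps_const (v\<^sup>2) * (b (2/3) * d)"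
        by (simp add: T_def algebra_simps)
      also have "\<dots> = fps_X * (1 + fps_const v * fps_exp (1/3) + fps_const (v\<^sup>2) * fps_exp (2/3))"
        unfolding bd by (simp add: distrib_left mult_ac)
      also have "fps_const (v\<^sup>2) * fps_exp (2/3) = u\<^sup>2"
        by (simp add: u_def power_mult_distrib fps_const_power fps_exp_power_mult)
      finally show ?thesis by (simp add: u_def)
    qed
    then show ?thesis by (simp add: mult_ac)
  qed
  also have "(u - 1) * (1 + u + u\<^sup>2) = u ^ 3 - 1"
    by (simp add: algebra_simps power2_eq_square power3_eq_cube)
  also have "u ^ 3 = fps_exp 1"
    by (simp add: u_def power_mult_distrib fps_const_power fps_exp_power_mult v3)
  finally have "(u - 1) * T * d = fps_X * d" by (simp add: d_def)
  then have uT: "(u - 1) * T = fps_X" using d0 by simp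
  \<comment> \<open>Composition with \<open>L\<close> multiplies the coefficient of index
    \<open>j\<close> by \<open>(2 pi i)^j\<close>, the factor built into
    \<open>bernoulli_twist\<close>.\<close>
  define L where "L = fps_const \<pi>2 * fps_X"
  have L0: "L $ 0 = 0" by (simp add: L_def)
  have "((u - 1) oo L) * (T oo L) = L"
    unfolding fps_compose_mult_distrib[OF L0, symmetric] uT by (simp add: fps_X_fps_compose fps_eq_iff L0)
  moreover have "(u - 1) oo L = E c"
    unfolding u_def E_def v_def[symmetric] fps_compose_sub_distrib fps_compose_mult_distrib[OF L0]
    by (simp add: L_def \<pi>2_def)
  moreover have "T oo L = Abs_fps (\<lambda>j. bernoulli_twist j c)"
  proof -
    have sum2: "(\<Sum>a = 0..2. f a) = f 0 + f 1 + f (2::nat)" for f :: "nat \<Rightarrow> complex"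
      by (simp add: numeral_2_eq_2)
    have "T $ j = (\<Sum>a = 0..2. bernoulli_poly j (of_nat a / 3) * v ^ a) / fact j" for j
      unfolding sum2 by (simp add: T_def bernoulli_poly_def b_def d_def field_simps)
    then show ?thesis
      unfolding L_def fps_compose_linear bernoulli_twist_def va by (simp add: fps_eq_iff \<pi>2_def)
  qed
  ultimately show ?thesis by (simp add: L_def \<pi>2_def)
qed

section \<open>Power sums over a residue class modulo 3\<close>

text \<open>At most one index satisfies \<open>c + 3 * k = 0\<close>, and it lies in the interval as
  soon as \<open>N \<ge> \<bar>c\<bar>\<close>, so the sums are eventually constant.\<close>

lemma tendsto_sum_delta_progression:
  fixes x :: complex and c :: int
  shows "(\<lambda>N. \<Sum>k\<in>{-int N..int N}. if c + 3 * k = 0 then x else 0) \<longlonglongrightarrow> (if 3 dvd c then x else 0)"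
proof (rule tendsto_eventually)
  show "\<forall>\<^sub>F N in sequentially. (\<Sum>k\<in>{-int N..int N}. if c + 3 * k = 0 then x else 0) = (if 3 dvd c then x else 0)"
    using eventually_ge_at_top[of "nat \<bar>c\<bar>"]
  proof eventually_elim
    case (elim N)
    show ?case
    proof (cases "3 dvd c")
      case True
      then obtain d where d: "c = 3 * d" by auto
      then have "c + 3 * k = 0 \<longleftrightarrow> k = - d" for k by auto
      moreover have "- d \<in> {-int N..int N}" using elim d by auto
      ultimately show ?thesis using True by simp
    next
      case False
      then have "c + 3 * k \<noteq> 0" for k by presburger
      then show ?thesis using False by simp
    qed
  qed
qed

text \<open>
  Since \<open>1 / 0 = 0\<close>, an index with \<open>c + 3 * k = 0\<close> contributes nothing. The correction at \<open>j = 1\<close> is the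
  constant by which \<open>2 \<pi> i / (e\<^bsup>2 \<pi> i w\<^esup> - 1)\<close> differs from \<open>\<pi> cot (\<pi> w)\<close>.
\<close>
lemma progression_power_sums:
  fixes c :: int
  defines "\<delta> \<equiv> if 3 dvd c then 3 else 0 :: complex"
  shows "bernoulli_twist 0 c = \<delta>"
    and "1 \<le> j \<Longrightarrow> (\<lambda>N. \<Sum>k\<in>{-int N..int N}. 1 / of_int (c + 3 * k) ^ j)
           \<longlonglongrightarrow> - (bernoulli_twist j c + (if j = 1 then of_real pi * \<i> else 0)) / 3"
proof -
  define m where "m = (\<lambda>k. complex_of_int (c + 3 * k))"
  define S where "S = (\<lambda>j. \<Sum>\<^sub>\<infinity>k. 1 / m k ^ j)"
  \<comment> \<open>Since \<open>w z - k = (z - m k) / 3\<close>, the cotangent series at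
    \<open>w z\<close> has its poles at the points \<open>m k\<close>, and the power sums appear as
    its Taylor coefficients at \<open>z = 0\<close>.\<close>
  define w where "w = (\<lambda>z::complex. (z - of_int c) / 3)"
  define X where "X = (\<lambda>z. exp (2 * of_real pi * \<i> * w z))"
  have bound: "norm (1 / m k ^ j) \<le> 1 / (real_of_int (c + 3 * k))\<^sup>2" if "j \<ge> 2" for k j
  proof (cases "c + 3 * k = 0")
    case False
    define R where "R = real_of_int (c + 3 * k)"
    have nm: "norm (m k) = \<bar>R\<bar>"
      unfolding m_def R_def by (rule norm_of_int)
    have R: "1 \<le> \<bar>R\<bar>" using False unfolding R_def by linarith
    then have "R\<^sup>2 \<le> \<bar>R\<bar> ^ j"
      using power_increasing[OF that R] by simp
    moreover have "0 < R\<^sup>2" using R by auto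
    ultimately show ?thesis
      unfolding norm_divide norm_power nm norm_one R_def[symmetric] by (intro frac_le) auto
  next
    case True
    then have "m k = 0" unfolding m_def by (simp only: of_int_0)
    then show ?thesis using that by (simp add: power_0_left)
  qed
  have sumS: "((\<lambda>k. 1 / m k ^ j) has_sum S j) UNIV" if "j \<ge> 2" for j
  proof -
    have "(\<lambda>k. 1 / m k ^ j) summable_on UNIV"
      using summable_on_inverse_squares_progression[of c] bound[OF that] by (rule summable_on_norm_bound)
    then show ?thesis unfolding S_def by (rule has_sum_infsum)
  qed
  \<comment> \<open>The powers with exponent at least 2 converge absolutely and are collected in
    \<open>Q\<close>; the sum of \<open>1 / m k\<close>, taken in symmetric order, is what remains
    of the cotangent series.\<close>
  have main: "\<exists>Q. (\<lambda>j. z ^ (j + 2) * S (j + 2)) sums Q \<and> X z \<noteq> 1 \<and>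
      (\<lambda>N. \<Sum>k\<in>{-int N..int N}. 1 / m k) \<longlonglongrightarrow>
        (\<delta> - 3 * Q - z * (2 * of_real pi * \<i> / (X z - 1) + of_real pi * \<i>)) / (3 * z)"
    if z: "z \<noteq> 0" "norm z < 1" for z
  proof -
    have znz: "z \<noteq> of_int n" for n
    proof
      assume "z = of_int n"
      with z(2) have "\<bar>n\<bar> < 1" by simp
      then have "n = 0" by simp
      with \<open>z = of_int n\<close> z(1) show False by simp
    qed
    have zm: "z \<noteq> m k" for k unfolding m_def by (rule znz)
    have wint: "w z \<notin> \<int>"
    proof
      assume "w z \<in> \<int>"
      then obtain n where "w z = of_int n" by (auto elim: Ints_cases)
      then have "z = of_int (3 * n + c)" by (simp add: w_def field_simps)
      with znz show False by blast
    qed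
    \<comment> \<open>The geometric series of \<open>z / m k\<close> from the second power on; for
      \<open>m k = 0\<close> all its terms and \<open>h k\<close> are 0.\<close>
    define h where "h = (\<lambda>k. z\<^sup>2 / (m k * (m k - z)))"
    define f where "f = (\<lambda>(k, j). z ^ (j + 2) * (1 / m k ^ (j + 2)))"
    have geo: "((\<lambda>j. norm z ^ (j + 2)) has_sum (norm z ^ 2 * (1 / (1 - norm z)))) UNIV"
    proof -
      have "(\<lambda>j. norm z ^ 2 * norm z ^ j) sums (norm z ^ 2 * (1 / (1 - norm z)))"
        using z by (intro sums_mult geometric_sums) auto
      then have "(\<lambda>j. norm z ^ (j + 2)) sums (norm z ^ 2 * (1 / (1 - norm z)))"
        by (simp add: power2_eq_square mult_ac)
      then show ?thesis by (intro sums_nonneg_imp_has_sum) auto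
    qed
    have fsum: "f summable_on UNIV \<times> UNIV"
    proof -
      have "(\<lambda>(k, j). 1 / (real_of_int (c + 3 * k))\<^sup>2 * norm z ^ (j + 2)) summable_on (UNIV \<times> UNIV)"
      proof (rule summable_on_SigmaI)
        show "(\<lambda>k. 1 / (real_of_int (c + 3 * k))\<^sup>2 * (norm z ^ 2 * (1 / (1 - norm z)))) summable_on UNIV"
          by (intro summable_on_cmult_left summable_on_inverse_squares_progression)
        show "((\<lambda>j. case (k, j) of (k, j) \<Rightarrow> 1 / (real_of_int (c + 3 * k))\<^sup>2 * norm z ^ (j + 2))
            has_sum (1 / (real_of_int (c + 3 * k))\<^sup>2 * (norm z ^ 2 * (1 / (1 - norm z))))) UNIV" for k
          unfolding prod.case by (rule has_sum_cmult_right[OF geo])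
      qed simp
      moreover have "norm (f x) \<le> (case x of (k, j) \<Rightarrow> 1 / (real_of_int (c + 3 * k))\<^sup>2 * norm z ^ (j + 2))" for x
      proof (cases x)
        case (Pair k j)
        have "norm (f (k, j)) = norm (1 / m k ^ (j + 2)) * norm z ^ (j + 2)"
          by (simp only: f_def prod.case norm_mult norm_power mult.commute)
        also have "\<dots> \<le> 1 / (real_of_int (c + 3 * k))\<^sup>2 * norm z ^ (j + 2)"
          by (intro mult_right_mono bound) auto
        finally show ?thesis using Pair by simp
      qed
      ultimately show ?thesis by (rule summable_on_norm_bound)
    qed
    define Q where "Q = infsum f (UNIV \<times> UNIV)"
    have fQ: "(f has_sum Q) (UNIV \<times> UNIV)"
      using fsum by (simp add: Q_def)
    have inner: "((\<lambda>j. f (k, j)) has_sum h k) UNIV" for k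
    proof (cases "m k = 0")
      case True
      then show ?thesis by (simp add: f_def h_def)
    next
      case False
      have "c + 3 * k \<noteq> 0" using False unfolding m_def by (metis of_int_0)
      then have "1 \<le> norm (m k)" unfolding m_def norm_of_int by linarith
      then have lt: "norm (z / m k) < 1"
        using z by (simp add: norm_divide divide_simps)
      have "(\<lambda>j. (z / m k)\<^sup>2 * (z / m k) ^ j) sums ((z / m k)\<^sup>2 * (1 / (1 - z / m k)))"
        by (intro sums_mult geometric_sums lt)
      moreover have "summable (\<lambda>j. norm ((z / m k)\<^sup>2 * (z / m k) ^ j))"
        unfolding norm_mult norm_power using lt by (intro summable_mult summable_geometric) auto
      ultimately have "((\<lambda>j. (z / m k)\<^sup>2 * (z / m k) ^ j) has_sum ((z / m k)\<^sup>2 * (1 / (1 - z / m k)))) UNIV"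
        by (intro norm_summable_imp_has_sum)
      moreover have "(z / m k)\<^sup>2 * (1 / (1 - z / m k)) = h k"
        using False zm[of k] by (simp add: h_def divide_simps power2_eq_square)
      moreover have "(\<lambda>j. (z / m k)\<^sup>2 * (z / m k) ^ j) = (\<lambda>j. f (k, j))"
        by (simp add: f_def power_divide power_add fun_eq_iff power2_eq_square mult.assoc)
      ultimately show ?thesis by simp
    qed
    have hQ: "(h has_sum Q) UNIV"
      using has_sum_SigmaD[OF fQ inner] by simp
    \<comment> \<open>Fubini: summing \<open>f\<close> over \<open>j\<close> first gave the sum of
      \<open>h\<close>, summing over \<open>k\<close> first gives the power series in
      \<open>z\<close>.\<close>
    have "((\<lambda>(j, k). f (k, j)) has_sum Q) (UNIV \<times> UNIV)"
      using fQ has_sum_swap by blast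
    then have "((\<lambda>j. z ^ (j + 2) * S (j + 2)) has_sum Q) UNIV"
    proof (rule has_sum_SigmaD)
      show "((\<lambda>k. case (j, k) of (j, k) \<Rightarrow> f (k, j)) has_sum z ^ (j + 2) * S (j + 2)) UNIV" for j
        unfolding prod.case f_def by (intro has_sum_cmult_right sumS) simp
    qed
    then have sums: "(\<lambda>j. z ^ (j + 2) * S (j + 2)) sums Q"
      by (rule has_sum_imp_sums)
    have lim1: "(\<lambda>N. \<Sum>k\<in>{-int N..int N}. z * (3 / (z - m k))) \<longlonglongrightarrow>
        z * (2 * of_real pi * \<i> / (X z - 1) + of_real pi * \<i>)"
    proof -
      have "(\<lambda>N. \<Sum>k\<in>{-int N..int N}. 1 / (w z + of_int (- k))) \<longlonglongrightarrow>
        2 * of_real pi * \<i> / (X z - 1) + of_real pi * \<i>"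
        using exp_partial_fractions(2)[OF wint] unfolding X_def
          sum_int_interval_uminus[of "\<lambda>k. 1 / (w z + of_int k)"] .
      moreover have "1 / (w z + of_int (- k)) = 3 / (z - m k)" for k
      proof -
        have "w z + of_int (- k) = (z - m k) / 3" by (simp add: w_def m_def field_simps)
        then show ?thesis by (simp only: divide_divide_eq_right mult_1)
      qed
      ultimately show ?thesis
        unfolding sum_distrib_left[symmetric] by (intro tendsto_mult_left) simp
    qed
    have m0: "m k = 0 \<longleftrightarrow> c + 3 * k = 0" for k
      unfolding m_def by (rule of_int_eq_0_iff)
    have lim2: "(\<lambda>N. \<Sum>k\<in>{-int N..int N}. if m k = 0 then 3 else 0) \<longlonglongrightarrow> \<delta>"
      unfolding m0 \<delta>_def by (rule tendsto_sum_delta_progression)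
    have lim3: "(\<lambda>N. \<Sum>k\<in>{-int N..int N}. h k) \<longlonglongrightarrow> Q"
      by (rule has_sum_int_imp_tendsto_symmetric[OF hQ])
    \<comment> \<open>For \<open>m k \<noteq> 0\<close> this is \<open>1 / (z - m k)\<close>
      expanded to first order with remainder \<open>h k\<close>. For \<open>m k = 0\<close> the term
      \<open>z * (3 / z) = 3\<close> is cancelled by the indicator, which is the origin of
      \<open>\<delta>\<close>.\<close>
    have "1 / m k = ((if m k = 0 then 3 else 0) - 3 * h k - z * (3 / (z - m k))) / (3 * z)" for k
    proof (cases "m k = 0")
      case True
      then show ?thesis using z by (simp add: h_def)
    next
      case False
      define d where "d = m k - z"
      have d: "d \<noteq> 0" "z - m k = - d" using zm[of k] by (auto simp: d_def)
      have "h k = z * z / (m k * d)" "z * (3 / (z - m k)) = - (3 * z * m k / (m k * d))"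
        using False unfolding d(2) by (simp_all add: h_def d_def[symmetric] power2_eq_square)
      then have "3 * h k + z * (3 / (z - m k)) = 3 * z * (z - m k) / (m k * d)"
        by (simp add: diff_divide_distrib right_diff_distrib mult.assoc)
      also have "\<dots> = - (3 * z / m k)" using d False by simp
      finally have eq: "3 * h k + z * (3 / (z - m k)) = - (3 * z / m k)" .
      have "(if m k = 0 then 3 else 0) - 3 * h k - z * (3 / (z - m k)) = - (3 * h k + z * (3 / (z - m k)))"
        using False by simp
      also have "\<dots> = 3 * z / m k" unfolding eq by simp
      finally have "(if m k = 0 then 3 else 0) - 3 * h k - z * (3 / (z - m k)) = 3 * z / m k" .
      then show ?thesis using z by simp
    qed
    then have "(\<Sum>k\<in>{-int N..int N}. 1 / m k) = ((\<Sum>k\<in>{-int N..int N}. if m k = 0 then 3 else 0)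
        - 3 * (\<Sum>k\<in>{-int N..int N}. h k) - (\<Sum>k\<in>{-int N..int N}. z * (3 / (z - m k)))) / (3 * z)" for N
      by (simp only: sum_subtractf sum_distrib_left sum_divide_distrib[symmetric])
    then have "(\<lambda>N. \<Sum>k\<in>{-int N..int N}. 1 / m k) \<longlonglongrightarrow>
        (\<delta> - 3 * Q - z * (2 * of_real pi * \<i> / (X z - 1) + of_real pi * \<i>)) / (3 * z)"
      using z by (simp only:) (intro tendsto_intros lim1 lim2 lim3, auto)
    moreover have "X z \<noteq> 1" unfolding X_def by (rule exp_partial_fractions(1)[OF wint])
    ultimately show ?thesis using sums by blast
  qed
  \<comment> \<open>The point \<open>1/2\<close> of the punctured disc only supplies the existence
    of the limit; by uniqueness the formula in \<open>main\<close> then gives its value at every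
    \<open>z\<close>.\<close>
  obtain S1 where S1: "(\<lambda>N. \<Sum>k\<in>{-int N..int N}. 1 / m k) \<longlonglongrightarrow> S1"
    using main[of "1/2"] by auto
  \<comment> \<open>The Taylor coefficients of \<open>val\<close>, to be identified with
    \<open>bernoulli_twist j c\<close>. The value \<open>\<delta>\<close> at 0 fills the removable
    singularity that occurs when 3 divides \<open>c\<close>.\<close>
  define b where "b = (\<lambda>j. if j = 0 then \<delta> else if j = 1 then - (of_real pi * \<i>) - 3 * S1 else - 3 * S j)"
  define val where "val = (\<lambda>z. if z = 0 then \<delta> else 2 * of_real pi * \<i> * z / (X z - 1))"
  have valsums: "(\<lambda>n. b n * z ^ n) sums val z" if z: "norm z < 1" for z
  proof (cases "z = 0")
    case True
    then show ?thesis using powser_sums_zero[of b] by (simp add: val_def b_def)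
  next
    case False
    obtain Q where Q: "(\<lambda>j. z ^ (j + 2) * S (j + 2)) sums Q" "X z \<noteq> 1"
      "(\<lambda>N. \<Sum>k\<in>{-int N..int N}. 1 / m k) \<longlonglongrightarrow>
        (\<delta> - 3 * Q - z * (2 * of_real pi * \<i> / (X z - 1) + of_real pi * \<i>)) / (3 * z)"
      using main[OF False z] by blast
    have S1eq: "S1 = (\<delta> - 3 * Q - z * (2 * of_real pi * \<i> / (X z - 1) + of_real pi * \<i>)) / (3 * z)"
      by (rule LIMSEQ_unique[OF S1 Q(3)])
    have "(\<lambda>j. - 3 * (z ^ (j + 2) * S (j + 2))) sums (- 3 * Q)"
      by (rule sums_mult[OF Q(1)])
    then have "(\<lambda>j. b (j + 2) * z ^ (j + 2)) sums (- 3 * Q)"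
      by (simp add: b_def mult_ac)
    then have "(\<lambda>j. b j * z ^ j) sums (- 3 * Q + (\<Sum>j<2. b j * z ^ j))"
      by (subst (asm) sums_iff_shift)
    moreover have "- 3 * Q + (\<Sum>j<2. b j * z ^ j) = val z"
      using False Q(2) S1eq by (simp add: b_def val_def numeral_2_eq_2 field_simps)
    ultimately show ?thesis by simp
  qed
  have val: "val has_fps_expansion Abs_fps b"
  proof (rule has_fps_expansionI)
    have "\<forall>\<^sub>F z in nhds 0. z \<in> ball (0::complex) 1"
      by (rule eventually_nhds_in_open) auto
    then show "\<forall>\<^sub>F u in nhds 0. (\<lambda>n. Abs_fps b $ n * u ^ n) sums val u"
      by eventually_elim (use valsums in auto)
  qed
  define v where "v = exp (- (2 * of_real pi * \<i> * of_int c / 3))"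
  define E where "E = fps_const v * fps_exp (2 * of_real pi * \<i> / 3) - 1"
  have Xv: "X z = v * exp (2 * of_real pi * \<i> / 3 * z)" for z
    unfolding X_def v_def w_def by (simp flip: exp_add add: field_simps)
  have "(\<lambda>z. X z - 1) has_fps_expansion E"
    unfolding E_def Xv by (intro fps_expansion_intros)
  then have "(\<lambda>z. (X z - 1) * val z) has_fps_expansion E * Abs_fps b"
    using val by (rule has_fps_expansion_mult)
  \<comment> \<open>The quotient is cleared so that \<open>z = 0\<close> is covered as well: there
    \<open>X 0 = 1\<close> if 3 divides \<open>c\<close>, and \<open>val 0 = 0\<close>
    otherwise.\<close>
  moreover have "\<forall>\<^sub>F z in nhds 0. (X z - 1) * val z = 2 * of_real pi * \<i> * z"
  proof -
    have "\<forall>\<^sub>F z in nhds 0. z \<in> ball (0::complex) 1"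
      by (rule eventually_nhds_in_open) auto
    then show ?thesis
    proof eventually_elim
      case (elim z)
      show ?case
      proof (cases "z = 0")
        case True
        have "X 0 = 1" if c3: "3 dvd c"
        proof -
          obtain d where d: "c = 3 * d" using c3 by auto
          have "X 0 = exp (of_int (2 * (- d)) * (of_real pi * \<i>))"
            unfolding X_def w_def by (simp add: d mult_ac)
          also have "\<dots> = 1"
            by (subst exp_eq_1) (auto intro!: exI[of _ "- d"])
          finally show ?thesis .
        qed
        then show ?thesis using True by (auto simp: val_def \<delta>_def)
      next
        case False
        with main[of z] elim show ?thesis by (auto simp: val_def)
      qed
    qed
  qed
  ultimately have "(\<lambda>z. 2 * of_real pi * \<i> * z) has_fps_expansion E * Abs_fps b"
    by (subst (asm) has_fps_expansion_cong) auto
  moreover have "(\<lambda>z. 2 * of_real pi * \<i> * z) has_fps_expansion fps_const (2 * of_real pi * \<i>) * fps_X"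
    by (intro fps_expansion_intros)
  ultimately have "E * Abs_fps b = fps_const (2 * of_real pi * \<i>) * fps_X"
    by (rule fps_expansion_unique_complex)
  also have "\<dots> = E * Abs_fps (\<lambda>j. bernoulli_twist j c)"
    unfolding E_def v_def by (rule bernoulli_twist_fps[symmetric])
  finally have "E * Abs_fps b = E * Abs_fps (\<lambda>j. bernoulli_twist j c)" .
  \<comment> \<open>The constant term of \<open>E\<close> may vanish, so the linear coefficient is
    what shows that \<open>E\<close> can be cancelled.\<close>
  moreover have "E $ 1 \<noteq> 0" by (simp add: E_def v_def)
  then have "E \<noteq> 0" by auto
  ultimately have "Abs_fps b = Abs_fps (\<lambda>j. bernoulli_twist j c)" by simp
  then have beq: "bernoulli_twist j c = b j" for j
    by (metis fps_nth_Abs_fps)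
  show "bernoulli_twist 0 c = \<delta>" by (simp add: beq b_def)
  show "(\<lambda>N. \<Sum>k\<in>{-int N..int N}. 1 / of_int (c + 3 * k) ^ j)
           \<longlonglongrightarrow> - (bernoulli_twist j c + (if j = 1 then of_real pi * \<i> else 0)) / 3" if "1 \<le> j"
  proof (cases "j = 1")
    case True
    then show ?thesis using S1 unfolding m_def by (simp add: beq b_def)
  next
    case False
    then have "j \<ge> 2" using that by simp
    from has_sum_int_imp_tendsto_symmetric[OF sumS[OF this]] show ?thesis
      using False that unfolding m_def by (simp add: beq b_def)
  qed
qed

section \<open>Partial fractions\<close>

text \<open>One half of the partial fraction expansion of \<open>X ^ (a + 1) * Y ^ (b + 1)\<close>.
  The exponents are shifted by 1 so that induction can start at \<open>a = b = 0\<close>.\<close>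

definition pf_sum :: "complex \<Rightarrow> nat \<Rightarrow> nat \<Rightarrow> complex \<Rightarrow> complex" where
  "pf_sum L a b X = (\<Sum>i\<le>a. of_nat ((i + b) choose b) * L ^ (i + b + 1) * X ^ (a + 1 - i))"

lemma pf_sum_0_left: "pf_sum L 0 (Suc b) X = L * pf_sum L 0 b X"
  by (simp add: pf_sum_def)

lemma pf_sum_0_right: "pf_sum L (Suc a) 0 X = L * (pf_sum L a 0 X + X ^ (Suc a + 1))"
  by (simp add: pf_sum_def sum.atMost_Suc_shift sum_distrib_left algebra_simps del: sum.atMost_Suc)

text \<open>Pascal's rule splits each coefficient with positive index; the summand with index 0
  occurs only in \<open>pf_sum L (Suc a) b X\<close>.\<close>

lemma pf_sum_Suc_Suc: "pf_sum L (Suc a) (Suc b) X = L * (pf_sum L a (Suc b) X + pf_sum L (Suc a) b X)"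
proof -
  have "pf_sum L (Suc a) (Suc b) X = L ^ (b + 2) * X ^ (a + 2) +
      (\<Sum>i\<le>a. of_nat ((Suc i + Suc b) choose Suc b) * L ^ (Suc i + Suc b + 1) * X ^ (a + 1 - i))"
    by (simp add: pf_sum_def sum.atMost_Suc_shift del: sum.atMost_Suc)
  also have "(\<Sum>i\<le>a. of_nat ((Suc i + Suc b) choose Suc b) * L ^ (Suc i + Suc b + 1) * X ^ (a + 1 - i)) =
     L * pf_sum L a (Suc b) X +
      (\<Sum>i\<le>a. of_nat ((Suc i + b) choose b) * L ^ (Suc i + b + 2) * X ^ (a + 1 - i))"
    by (simp add: pf_sum_def sum_distrib_left algebra_simps flip: sum.distrib)
  also have "(\<Sum>i\<le>a. of_nat ((Suc i + b) choose b) * L ^ (Suc i + b + 2) * X ^ (a + 1 - i)) =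
     L * pf_sum L (Suc a) b X - L ^ (b + 2) * X ^ (a + 2)"
    by (simp add: pf_sum_def sum.atMost_Suc_shift sum_distrib_left algebra_simps del: sum.atMost_Suc)
  finally show ?thesis by (simp add: algebra_simps)
qed

text \<open>Here \<open>X = 1 / x\<close>, \<open>Y = 1 / y\<close> and \<open>L = 1 / (x + y)\<close>.\<close>
lemma partial_fractions_reciprocals:
  fixes X Y L :: complex
  assumes "X * Y = L * (X + Y)"
  shows "X ^ (a + 1) * Y ^ (b + 1) = pf_sum L a b X + pf_sum L b a Y"
proof (induction "a + b" arbitrary: a b rule: less_induct)
  case less
  \<comment> \<open>Replacing one factor \<open>X * Y\<close> by \<open>L * (X + Y)\<close> lowers
    the total degree in \<open>X\<close> and \<open>Y\<close> by 1.\<close>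
  have step: "X ^ (Suc a' + 1) * Y ^ (Suc b' + 1) = L * (X ^ (a' + 1) * Y ^ (Suc b' + 1) + X ^ (Suc a' + 1) * Y ^ (b' + 1))" for a' b'
  proof -
    have "X ^ (Suc a' + 1) * Y ^ (Suc b' + 1) = (X * Y) * (X ^ (a' + 1) * Y ^ (b' + 1))" by (simp add: mult_ac)
    then show ?thesis unfolding assms by (simp add: algebra_simps)
  qed
  \<comment> \<open>Here one exponent drops to 0; the resulting pure power is the extra term in
    \<open>pf_sum_0_right\<close>.\<close>
  have stepX: "X ^ (Suc a' + 1) * Y = L * (X ^ (a' + 1) * Y + X ^ (Suc a' + 1))" for a'
  proof -
    have "X ^ (Suc a' + 1) * Y = (X * Y) * X ^ (a' + 1)" by (simp add: mult_ac)
    then show ?thesis unfolding assms by (simp add: algebra_simps)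
  qed
  have stepY: "X * Y ^ (Suc b' + 1) = L * (X * Y ^ (b' + 1) + Y ^ (Suc b' + 1))" for b'
  proof -
    have "X * Y ^ (Suc b' + 1) = (X * Y) * Y ^ (b' + 1)" by (simp add: mult_ac)
    then show ?thesis unfolding assms by (simp add: algebra_simps)
  qed
  show ?case
  proof (cases a)
    case a0: 0
    show ?thesis
    proof (cases b)
      case 0
      then show ?thesis using a0 assms by (simp add: pf_sum_def algebra_simps)
    next
      case (Suc b')
      have "X * Y ^ (b' + 1) = pf_sum L 0 b' X + pf_sum L b' 0 Y"
        using less[of 0 b'] a0 Suc by simp
      then show ?thesis using stepY[of b'] unfolding a0 Suc pf_sum_0_left pf_sum_0_right by (simp add: algebra_simps)
    qed
  next
    case a: (Suc a')
    show ?thesis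
    proof (cases b)
      case 0
      have "X ^ (a' + 1) * Y = pf_sum L a' 0 X + pf_sum L 0 a' Y"
        using less[of a' 0] a 0 by simp
      then show ?thesis using stepX[of a'] unfolding a 0 pf_sum_0_left pf_sum_0_right by (simp add: algebra_simps)
    next
      case (Suc b')
      have "X ^ (a' + 1) * Y ^ (Suc b' + 1) = pf_sum L a' (Suc b') X + pf_sum L (Suc b') a' Y"
        using less[of a' "Suc b'"] a Suc by simp
      moreover have "X ^ (Suc a' + 1) * Y ^ (b' + 1) = pf_sum L (Suc a') b' X + pf_sum L b' (Suc a') Y"
        using less[of "Suc a'" b'] a Suc by simp
      ultimately show ?thesis using step[of a' b'] unfolding a Suc pf_sum_Suc_Suc by (simp add: algebra_simps)
    qed
  qed
qed

lemma pf_sum_reindex: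
  assumes "1 \<le> p" "1 \<le> q"
  shows "pf_sum L (p - 1) (q - 1) X =
    (\<Sum>j = 1..p. of_nat ((p + q - j - 1) choose (q - 1)) * L ^ (p + q - j) * X ^ j)"
  unfolding pf_sum_def
  by (rule sum.reindex_bij_witness[of _ "\<lambda>j. p - j" "\<lambda>i. p - i"]) (use assms in \<open>auto simp: Suc_diff_le add.commute\<close>)

lemma partial_fractions:
  fixes x y :: complex
  assumes "x \<noteq> 0" "y \<noteq> 0" "x + y \<noteq> 0" "1 \<le> p" "1 \<le> q"
  shows "1 / (x ^ p * y ^ q) =
     (\<Sum>j = 1..p. of_nat ((p + q - j - 1) choose (q - 1)) * (1 / (x + y)) ^ (p + q - j) * (1 / x ^ j)) +
     (\<Sum>j = 1..q. of_nat ((p + q - j - 1) choose (p - 1)) * (1 / (x + y)) ^ (p + q - j) * (1 / y ^ j))"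
proof -
  have "1 / x * (1 / y) = 1 / (x + y) * (1 / x + 1 / y)"
    using assms by (simp add: field_simps)
  from partial_fractions_reciprocals[OF this, of "p - 1" "q - 1"]
  show ?thesis
    using assms pf_sum_reindex[of p q "1 / (x + y)" "1 / x"] pf_sum_reindex[of q p "1 / (x + y)" "1 / y"]
    by (simp add: power_divide add.commute)
qed

section \<open>The sum over one residue class for fixed l\<close>

text \<open>The hockey-stick identity. It identifies the corrections for the two omitted indices
  with the coefficients at \<open>\<tau> = 0\<close>.\<close>

lemma sum_choose_partial_fractions:
  assumes "1 \<le> p" "1 \<le> q"
  shows "(\<Sum>j = 1..p. (p + q - j - 1) choose (q - 1)) = (p + q - 1) choose (p - 1)"
proof -
  have "(\<Sum>j = 1..p. (p + q - j - 1) choose (q - 1)) = (\<Sum>k\<le>p - 1. (q - 1 + k) choose k)"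
  proof (rule sum.reindex_bij_witness[of _ "\<lambda>k. p - k" "\<lambda>j. p - j"])
    fix j assume "j \<in> {1..p}"
    then show "(q - 1 + (p - j)) choose (p - j) = (p + q - j - 1) choose (q - 1)"
      using assms binomial_symmetric[of "p - j" "q - 1 + (p - j)"] by (simp add: add.commute)
  qed (use assms in auto)
  also have "\<dots> = Suc (q - 1 + (p - 1)) choose (p - 1)" by (rule sum_choose_lower)
  also have "Suc (q - 1 + (p - 1)) = p + q - 1" using assms by simp
  finally show ?thesis .
qed

text \<open>With \<open>m = 3 * k - l\<close>, the excluded indices \<open>m = 0\<close> and \<open>m = l\<close> drop out because \<open>1 / 0 = 0\<close>.\<close>
lemma progression_product_sum:
  fixes l p q :: nat
  assumes l: "1 \<le> l" and p: "1 \<le> p" and q: "1 \<le> q"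
    and W: "((\<lambda>k. 1 / (of_int (3 * k - int l) ^ p * of_int (2 * int l - 3 * k) ^ q)) has_sum W) UNIV"
  shows "3 * W =
    - (\<Sum>\<tau> = 0..p. of_nat ((p + q - \<tau> - 1) choose (q - 1)) * (1 / of_nat l) ^ (p + q - \<tau>)
          * ((- 1) ^ \<tau> * bernoulli_twist \<tau> (int l)))
    - (\<Sum>\<tau> = 0..q. of_nat ((p + q - \<tau> - 1) choose (p - 1)) * (1 / of_nat l) ^ (p + q - \<tau>)
          * bernoulli_twist \<tau> (2 * int l))"
proof -
  define L where "L = 1 / complex_of_nat l"
  define m n where "m = (\<lambda>k. complex_of_int (3 * k - int l))" and "n = (\<lambda>k. complex_of_int (2 * int l - 3 * k))"
  define A B where "A = (\<lambda>\<tau>. of_nat ((p + q - \<tau> - 1) choose (q - 1)) * L ^ (p + q - \<tau>))"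
    and "B = (\<lambda>\<tau>. of_nat ((p + q - \<tau> - 1) choose (p - 1)) * L ^ (p + q - \<tau>))"
  \<comment> \<open>\<open>CB\<close> is the value of the \<open>n\<close>-half of the expansion
    where \<open>m k = 0\<close> and \<open>n k = l\<close>; \<open>CA\<close> is that of the
    \<open>m\<close>-half where \<open>n k = 0\<close>.\<close>
  define CA CB where "CA = (\<Sum>j = 1..p. A j * L ^ j)" and "CB = (\<Sum>j = 1..q. B j * L ^ j)"
  have l0: "complex_of_nat l \<noteq> 0" using l by simp
  have mn: "m k + n k = of_nat l" for k
    unfolding m_def n_def of_int_add[symmetric] by simp
  have m0: "m k = 0 \<longleftrightarrow> - int l + 3 * k = 0" for k
    unfolding m_def of_int_eq_0_iff by auto
  have n0: "n k = 0 \<longleftrightarrow> - 2 * int l + 3 * k = 0" for k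
    unfolding n_def of_int_eq_0_iff by auto
  \<comment> \<open>Partial fractions made valid for every \<open>k\<close>: where
    \<open>m k\<close> or \<open>n k\<close> vanishes, the left side is 0 but the half in the other
    variable survives and has to be subtracted.\<close>
  have g: "1 / (m k ^ p * n k ^ q) = (\<Sum>j = 1..p. A j * (1 / m k ^ j)) + (\<Sum>j = 1..q. B j * (1 / n k ^ j))
      - (if - int l + 3 * k = 0 then CB else 0) - (if - 2 * int l + 3 * k = 0 then CA else 0)" for k
  proof -
    consider "m k = 0" | "n k = 0" | "m k \<noteq> 0" "n k \<noteq> 0" by blast
    then show ?thesis
    proof cases
      case 1
      then have nk: "n k = of_nat l" using mn[of k] by simp
      then have "n k \<noteq> 0" using l0 by simp
      with 1 show ?thesis using p unfolding m0[symmetric] n0[symmetric] CB_def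
        by (simp add: nk L_def power_0_left power_divide)
    next
      case 2
      then have mk: "m k = of_nat l" using mn[of k] by simp
      then have "m k \<noteq> 0" using l0 by simp
      with 2 show ?thesis using q unfolding m0[symmetric] n0[symmetric] CA_def
        by (simp add: mk L_def power_0_left power_divide)
    next
      case 3
      then show ?thesis
        unfolding partial_fractions[OF 3, unfolded mn, OF l0 p q] m0[symmetric] n0[symmetric]
        by (simp add: A_def B_def L_def)
    qed
  qed
  define s where "s = (\<lambda>j c. - (bernoulli_twist j c + (if j = 1 then of_real pi * \<i> else 0)) / 3)"
  have s3: "3 * s j c = - bernoulli_twist j c - (if j = 1 then of_real pi * \<i> else 0)" for j c
    by (simp add: s_def)
  have alg: "(- a + x) + (- b - x) - 3 * d * u - 3 * d * v = - (3 * d * u + a) - (3 * d * v + b)"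
    for a b d u v x :: complex by (simp add: algebra_simps)
  \<comment> \<open>Reversing \<open>k\<close> turns \<open>m k\<close> into the negative of the
    progression of \<open>l\<close>, whence the sign \<open>(- 1) ^ j\<close>; the same reversal
    turns \<open>n k\<close> into the progression of \<open>2 * l\<close>.\<close>
  have lim_m: "(\<lambda>N. \<Sum>k\<in>{-int N..int N}. 1 / m k ^ j) \<longlonglongrightarrow> (- 1) ^ j * s j (int l)" if "1 \<le> j" for j
  proof -
    have "1 / m k ^ j = (- 1) ^ j * (1 / of_int (int l + 3 * (- k)) ^ j)" for k
    proof -
      have "m k = - of_int (int l + 3 * (- k))" by (simp add: m_def)
      then have "m k ^ j = (- 1) ^ j * of_int (int l + 3 * (- k)) ^ j"
        by (metis power_minus)
      then show ?thesis by (cases "even j") simp_all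
    qed
    then have "(\<Sum>k\<in>{-int N..int N}. 1 / m k ^ j) = (- 1) ^ j * (\<Sum>k\<in>{-int N..int N}. 1 / of_int (int l + 3 * k) ^ j)" for N
      by (simp only: sum_distrib_left[symmetric] sum_int_interval_uminus[of "\<lambda>k. 1 / of_int (int l + 3 * k) ^ j"])
    then show ?thesis
      unfolding s_def by (simp only:) (intro tendsto_mult_left progression_power_sums(2) that)
  qed
  have lim_n: "(\<lambda>N. \<Sum>k\<in>{-int N..int N}. 1 / n k ^ j) \<longlonglongrightarrow> s j (2 * int l)" if "1 \<le> j" for j
  proof -
    have "n k = of_int (2 * int l + 3 * (- k))" for k by (simp add: n_def)
    then have "(\<Sum>k\<in>{-int N..int N}. 1 / n k ^ j) = (\<Sum>k\<in>{-int N..int N}. 1 / of_int (2 * int l + 3 * k) ^ j)" for N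
      by (simp only: sum_int_interval_uminus[of "\<lambda>k. 1 / of_int (2 * int l + 3 * k) ^ j"])
    then show ?thesis
      unfolding s_def by (simp only:) (intro progression_power_sums(2) that)
  qed
  define \<delta> where "\<delta> = (if 3 dvd int l then 1 else 0 :: complex)"
  have dvd: "3 dvd - int l \<longleftrightarrow> 3 dvd int l" "3 dvd - 2 * int l \<longleftrightarrow> 3 dvd int l" "3 dvd 2 * int l \<longleftrightarrow> 3 dvd int l"
    by presburger+
  have "(\<lambda>N. \<Sum>k\<in>{-int N..int N}. 1 / (m k ^ p * n k ^ q)) \<longlonglongrightarrow> W"
    using has_sum_int_imp_tendsto_symmetric[OF W] by (simp only: m_def n_def)
  \<comment> \<open>The part with \<open>j = 1\<close> need not converge absolutely, so the
    expansion is split within symmetric partial sums before passing to the limit.\<close>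
  moreover have "(\<lambda>N. \<Sum>k\<in>{-int N..int N}. 1 / (m k ^ p * n k ^ q)) \<longlonglongrightarrow>
     (\<Sum>j = 1..p. A j * ((- 1) ^ j * s j (int l))) + (\<Sum>j = 1..q. B j * s j (2 * int l)) - \<delta> * CB - \<delta> * CA"
  proof -
    have eq: "(\<Sum>k\<in>{-int N..int N}. 1 / (m k ^ p * n k ^ q)) =
      (\<Sum>j = 1..p. A j * (\<Sum>k\<in>{-int N..int N}. 1 / m k ^ j)) + (\<Sum>j = 1..q. B j * (\<Sum>k\<in>{-int N..int N}. 1 / n k ^ j))
      - (\<Sum>k\<in>{-int N..int N}. if - int l + 3 * k = 0 then CB else 0)
      - (\<Sum>k\<in>{-int N..int N}. if - 2 * int l + 3 * k = 0 then CA else 0)" for N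
      unfolding g sum_subtractf sum.distrib sum_distrib_left
      by (simp only: sum.swap[of _ "{1..p}"] sum.swap[of _ "{1..q}"])
    have "(\<lambda>N. \<Sum>k\<in>{-int N..int N}. if - int l + 3 * k = 0 then CB else 0) \<longlonglongrightarrow> \<delta> * CB"
      using tendsto_sum_delta_progression[of "- int l" CB] unfolding dvd \<delta>_def by (simp split: if_splits)
    moreover have "(\<lambda>N. \<Sum>k\<in>{-int N..int N}. if - 2 * int l + 3 * k = 0 then CA else 0) \<longlonglongrightarrow> \<delta> * CA"
      using tendsto_sum_delta_progression[of "- 2 * int l" CA] unfolding dvd \<delta>_def by (simp split: if_splits)
    ultimately show ?thesis
      unfolding eq by (intro tendsto_diff tendsto_add tendsto_sum tendsto_mult_left lim_m lim_n) auto
  qed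
  ultimately have "W = (\<Sum>j = 1..p. A j * ((- 1) ^ j * s j (int l))) + (\<Sum>j = 1..q. B j * s j (2 * int l)) - \<delta> * CB - \<delta> * CA"
    by (rule LIMSEQ_unique)
  then have "3 * W = (\<Sum>j = 1..p. A j * ((- 1) ^ j * (3 * s j (int l)))) + (\<Sum>j = 1..q. B j * (3 * s j (2 * int l)))
      - 3 * \<delta> * CB - 3 * \<delta> * CA"
  proof -
    have "(\<Sum>j = 1..p. A j * ((- 1) ^ j * (3 * s j (int l)))) = 3 * (\<Sum>j = 1..p. A j * ((- 1) ^ j * s j (int l)))"
      "(\<Sum>j = 1..q. B j * (3 * s j (2 * int l))) = 3 * (\<Sum>j = 1..q. B j * s j (2 * int l))"
      by (simp_all add: sum_distrib_left mult_ac)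
    then show ?thesis
      unfolding \<open>W = _\<close> by (simp only: distrib_left right_diff_distrib mult.assoc)
  qed
  also have "(\<Sum>j = 1..p. A j * ((- 1) ^ j * (3 * s j (int l)))) =
      - (\<Sum>j = 1..p. A j * ((- 1) ^ j * bernoulli_twist j (int l))) + A 1 * (of_real pi * \<i>)"
  proof -
    have "(\<Sum>j = 1..p. A j * ((- 1) ^ j * (3 * s j (int l)))) =
      (\<Sum>j = 1..p. - (A j * ((- 1) ^ j * bernoulli_twist j (int l))) + (if j = 1 then A 1 * (of_real pi * \<i>) else 0))"
      unfolding s3 by (intro sum.cong) (auto simp: algebra_simps)
    then show ?thesis using p by (simp add: sum_subtractf)
  qed
  also have "(\<Sum>j = 1..q. B j * (3 * s j (2 * int l))) =
      - (\<Sum>j = 1..q. B j * bernoulli_twist j (2 * int l)) - B 1 * (of_real pi * \<i>)"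
  proof -
    have "(\<Sum>j = 1..q. B j * (3 * s j (2 * int l))) =
      (\<Sum>j = 1..q. - (B j * bernoulli_twist j (2 * int l)) - (if j = 1 then B 1 * (of_real pi * \<i>) else 0))"
      unfolding s3 by (intro sum.cong) (auto simp: algebra_simps)
    then show ?thesis using q by (simp add: sum_subtractf sum_negf)
  qed
  \<comment> \<open>The constants \<open>pi * \<i>\<close> at \<open>j = 1\<close> enter with
    weights \<open>A 1\<close> and \<open>- B 1\<close>, so this symmetry of binomial coefficients
    cancels them.\<close>
  also have "B 1 = A 1"
    using binomial_symmetric[of "p - 1" "p + q - 1 - 1"] p q by (simp add: A_def B_def)
  also have "CB = A 0"
  proof -
    have "CB = (\<Sum>j = 1..q. of_nat ((q + p - j - 1) choose (p - 1)) * L ^ (p + q))"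
      unfolding CB_def B_def by (intro sum.cong) (auto simp: mult.assoc add.commute simp flip: power_add)
    also have "\<dots> = of_nat (\<Sum>j = 1..q. ((q + p - j - 1) choose (p - 1))) * L ^ (p + q)"
      by (simp add: sum_distrib_right)
    finally show ?thesis
      unfolding sum_choose_partial_fractions[OF q p] by (simp add: A_def add.commute)
  qed
  also have "CA = B 0"
  proof -
    have "CA = (\<Sum>j = 1..p. of_nat ((p + q - j - 1) choose (q - 1)) * L ^ (p + q))"
      unfolding CA_def A_def by (intro sum.cong) (auto simp: mult.assoc simp flip: power_add)
    also have "\<dots> = of_nat (\<Sum>j = 1..p. ((p + q - j - 1) choose (q - 1))) * L ^ (p + q)"
      by (simp add: sum_distrib_right)
    finally show ?thesis
      unfolding sum_choose_partial_fractions[OF p q] by (simp add: B_def)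
  qed
  finally have "3 * W = - (3 * \<delta> * A 0 + (\<Sum>j = 1..p. A j * ((- 1) ^ j * bernoulli_twist j (int l))))
      - (3 * \<delta> * B 0 + (\<Sum>j = 1..q. B j * bernoulli_twist j (2 * int l)))"
    by (simp only: alg)
  \<comment> \<open>Because \<open>bernoulli_twist 0\<close> equals 3 times \<open>\<delta>\<close>,
    the correction for an omitted index becomes the term \<open>\<tau> = 0\<close>.\<close>
  also have "3 * \<delta> * A 0 + (\<Sum>j = 1..p. A j * ((- 1) ^ j * bernoulli_twist j (int l))) =
      (\<Sum>j = 0..p. A j * ((- 1) ^ j * bernoulli_twist j (int l)))"
    by (simp add: sum.atLeast_Suc_atMost[of 0] progression_power_sums(1) \<delta>_def)
  also have "3 * \<delta> * B 0 + (\<Sum>j = 1..q. B j * bernoulli_twist j (2 * int l)) =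
      (\<Sum>j = 0..q. B j * bernoulli_twist j (2 * int l))"
    by (simp add: sum.atLeast_Suc_atMost[of 0] progression_power_sums(1) \<delta>_def dvd)
  finally show ?thesis by (simp only: A_def B_def L_def)
qed

section \<open>The relation in the region of convergence\<close>

lemma summable_on_inverse_squares_pairs:
  "(\<lambda>(m::nat, n::nat). 1 / (real m)\<^sup>2 * (1 / (real n)\<^sup>2)) summable_on UNIV \<times> UNIV"
proof (rule summable_on_SigmaI)
  show "((\<lambda>n. case (m, n) of (m, n) \<Rightarrow> 1 / (real m)\<^sup>2 * (1 / (real n)\<^sup>2)) has_sum
      1 / (real m)\<^sup>2 * (\<Sum>\<^sub>\<infinity>n. 1 / (real n)\<^sup>2)) UNIV" for m
    unfolding prod.case by (intro has_sum_cmult_right has_sum_infsum summable_on_inverse_squares_nat)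
  show "(\<lambda>m. 1 / (real m)\<^sup>2 * (\<Sum>\<^sub>\<infinity>n. 1 / (real n)\<^sup>2)) summable_on UNIV"
    by (intro summable_on_cmult_left summable_on_inverse_squares_nat)
qed auto

lemma norm_of_nat_powr_ge:
  assumes "1 \<le> (n::nat)" "real r \<le> Re s"
  shows "real n ^ r \<le> norm (of_nat n powr s :: complex)"
proof -
  have "norm (of_nat n powr s :: complex) = real n powr Re s"
    using assms by (subst norm_powr_real_powr) auto
  moreover have "real n powr real r \<le> real n powr Re s"
    using assms by (intro powr_mono) auto
  ultimately show ?thesis using assms by (simp add: powr_realpow)
qed

lemma PU3_term_summable_on:
  fixes s :: "complex ^ 3"
  assumes "\<And>m n. 1 \<le> m \<Longrightarrow> 1 \<le> n \<Longrightarrow>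
    (real m)\<^sup>2 * (real n)\<^sup>2 \<le> norm (of_nat m powr (s $ 1) * of_nat n powr (s $ 2) * of_nat (m + n) powr (s $ 3))"
  shows "PU3_term s summable_on PU3_index"
proof (rule summable_on_norm_bound)
  show "(\<lambda>(m::nat, n::nat). 1 / (real m)\<^sup>2 * (1 / (real n)\<^sup>2)) summable_on PU3_index"
    using summable_on_inverse_squares_pairs by (rule summable_on_subset_banach) auto
  fix x assume "x \<in> PU3_index"
  then obtain m n where x: "x = (m, n)" "1 \<le> m" "1 \<le> n" by (auto simp: PU3_index_def)
  have "norm (PU3_term s x) = 1 / norm (of_nat m powr (s $ 1) * of_nat n powr (s $ 2) * of_nat (m + n) powr (s $ 3))"
    by (simp only: x PU3_term_def prod.case norm_divide norm_one)
  also have "\<dots> \<le> 1 / ((real m)\<^sup>2 * (real n)\<^sup>2)"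
    using x by (intro frac_le assms) auto
  finally show "norm (PU3_term s x) \<le> (case x of (m, n) \<Rightarrow> 1 / (real m)\<^sup>2 * (1 / (real n)\<^sup>2))"
    by (simp add: x)
qed

lemma PU3_convergence_last:
  assumes p: "1 \<le> p" and q: "1 \<le> q" and s: "2 < Re s"
  shows "vector [of_nat p, of_nat q, s] \<in> zeta2_PU3_convergence"
  unfolding zeta2_PU3_convergence_def mem_Collect_eq
proof (rule PU3_term_summable_on)
  fix m n :: nat assume mn: "1 \<le> m" "1 \<le> n"
  \<comment> \<open>The two powers gained from \<open>m + n\<close> make up one further factor
    \<open>m\<close> and one further factor \<open>n\<close>.\<close>
  have "real m * real n \<le> (real (m + n))\<^sup>2"
    by (simp add: power2_eq_square algebra_simps)
  then have "(real m)\<^sup>2 * (real n)\<^sup>2 \<le> real m ^ 1 * real n ^ 1 * real (m + n) ^ 2"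
    using mult_left_mono[of "real m * real n" "(real (m + n))\<^sup>2" "real m * real n"]
    by (simp add: power2_eq_square mult_ac)
  also have "\<dots> \<le> norm (of_nat m powr of_nat p :: complex) * norm (of_nat n powr of_nat q :: complex) *
      norm (of_nat (m + n) powr s)"
    using mn p q s by (intro mult_mono norm_of_nat_powr_ge) auto
  finally show "(real m)\<^sup>2 * (real n)\<^sup>2 \<le> norm (of_nat m powr ((vector [of_nat p, of_nat q, s] :: complex ^ 3) $ 1) *
     of_nat n powr ((vector [of_nat p, of_nat q, s] :: complex ^ 3) $ 2) *
     of_nat (m + n) powr ((vector [of_nat p, of_nat q, s] :: complex ^ 3) $ 3))"
    unfolding vector_3 norm_mult .
qed

lemma PU3_convergence_middle:
  assumes p: "1 \<le> p" and q: "1 \<le> q" and s: "2 < Re s"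
  shows "vector [of_nat p, s, of_nat q] \<in> zeta2_PU3_convergence"
  unfolding zeta2_PU3_convergence_def mem_Collect_eq
proof (rule PU3_term_summable_on)
  fix m n :: nat assume mn: "1 \<le> m" "1 \<le> n"
  have "(real m)\<^sup>2 * (real n)\<^sup>2 \<le> real m ^ 1 * real n ^ 2 * real (m + n) ^ 1"
    by (simp add: power2_eq_square algebra_simps)
  also have "\<dots> \<le> norm (of_nat m powr of_nat p :: complex) * norm (of_nat n powr s) *
      norm (of_nat (m + n) powr of_nat q :: complex)"
    using mn p q s by (intro mult_mono norm_of_nat_powr_ge) auto
  finally show "(real m)\<^sup>2 * (real n)\<^sup>2 \<le> norm (of_nat m powr ((vector [of_nat p, s, of_nat q] :: complex ^ 3) $ 1) *
     of_nat n powr ((vector [of_nat p, s, of_nat q] :: complex ^ 3) $ 2) *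
     of_nat (m + n) powr ((vector [of_nat p, s, of_nat q] :: complex ^ 3) $ 3))"
    unfolding vector_3 norm_mult .
qed

lemma zeta2_PU3_series_has_sum:
  assumes "w \<in> zeta2_PU3_convergence"
  shows "(PU3_term w has_sum zeta2_PU3_series w) PU3_index"
  using assms by (simp add: zeta2_PU3_series_def zeta2_PU3_convergence_def)

section \<open>Merging the three zeta values into one double sum\<close>

text \<open>The ranges \<open>0 < m < l\<close>, \<open>m < 0\<close> and \<open>l < m\<close> of \<open>m = 3 * k - l\<close> belong to the three zeta values.\<close>
lemma bij_betw_PU3_index:
  shows "bij_betw (\<lambda>(m, n). (m + n, (2 * int m + int n) div 3)) PU3_index
           {(l, k). 1 \<le> l \<and> 0 < 3 * k - int l \<and> 3 * k - int l < int l}"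
    and "bij_betw (\<lambda>(m, n). (n, (int n - int m) div 3)) PU3_index
           {(l, k). 1 \<le> l \<and> 3 * k - int l < 0}"
    and "bij_betw (\<lambda>(m, n). (n, (int m + 2 * int n) div 3)) PU3_index
           {(l, k). 1 \<le> l \<and> int l < 3 * k - int l}"
proof -
  have 3: "3 * ((2 * int m + int n) div 3) = 2 * int m + int n" "3 * ((int n - int m) div 3) = int n - int m"
      "3 * ((int m + 2 * int n) div 3) = int m + 2 * int n"
    if "m mod 3 = n mod 3" for m n :: nat
    using that by presburger+
  have nat_mod: "nat x mod 3 = nat y mod 3" if "0 \<le> x" "0 \<le> y" "3 dvd x - y" for x y :: int
    using that by (metis nat_mod_distrib mod_eq_dvd_iff nat_numeral zero_le_numeral)
  have nat_mod': "nat x mod 3 = l mod 3" if "0 \<le> x" "3 dvd x - int l" for x l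
    using nat_mod[of x "int l"] that by simp
  show "bij_betw (\<lambda>(m, n). (m + n, (2 * int m + int n) div 3)) PU3_index
           {(l, k). 1 \<le> l \<and> 0 < 3 * k - int l \<and> 3 * k - int l < int l}"
    by (rule bij_betwI[where g = "\<lambda>(l, k). (nat (3 * k - int l), nat (2 * int l - 3 * k))"])
       (auto simp: PU3_index_def 3 intro!: nat_mod nat_mod')
  show "bij_betw (\<lambda>(m, n). (n, (int n - int m) div 3)) PU3_index {(l, k). 1 \<le> l \<and> 3 * k - int l < 0}"
    by (rule bij_betwI[where g = "\<lambda>(l, k). (nat (int l - 3 * k), l)"])
       (auto simp: PU3_index_def 3 intro!: nat_mod nat_mod')
  show "bij_betw (\<lambda>(m, n). (n, (int m + 2 * int n) div 3)) PU3_index {(l, k). 1 \<le> l \<and> int l < 3 * k - int l}"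
    by (rule bij_betwI[where g = "\<lambda>(l, k). (nat (3 * k - 2 * int l), l)"])
       (auto simp: PU3_index_def 3 intro!: nat_mod nat_mod')
qed

lemma has_sum_finite_sum:
  fixes f :: "'i \<Rightarrow> 'a \<Rightarrow> complex"
  assumes "\<And>i. i \<in> I \<Longrightarrow> (f i has_sum S i) A"
  shows "((\<lambda>x. \<Sum>i\<in>I. f i x) has_sum (\<Sum>i\<in>I. S i)) A"
proof (cases "finite I")
  case True
  then show ?thesis using assms
    by (induction I rule: finite_induct) (auto intro!: has_sum_add)
qed simp

lemma lerch_series_has_sum:
  assumes "2 \<le> Re z"
  shows "((\<lambda>m. exp (2 * of_real pi * \<i> * of_nat m * of_real \<alpha>) * of_nat m powr (- z))
           has_sum lerch_series z \<alpha>) {1::nat..}"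
proof -
  have "(\<lambda>m. exp (2 * of_real pi * \<i> * of_nat m * of_real \<alpha>) * of_nat m powr (- z)) summable_on {1::nat..}"
  proof (rule summable_on_norm_bound)
    show "(\<lambda>n::nat. 1 / (real n)\<^sup>2) summable_on {1..}"
      using summable_on_inverse_squares_nat by (rule summable_on_subset_banach) auto
    fix m :: nat assume "m \<in> {1..}"
    then have m: "1 \<le> m" by simp
    have "norm (exp (2 * of_real pi * \<i> * of_nat m * of_real \<alpha>)) = 1"
      by (simp add: norm_exp_eq_Re)
    then have "norm (exp (2 * of_real pi * \<i> * of_nat m * of_real \<alpha>) * of_nat m powr (- z))
        = 1 / norm (of_nat m powr z :: complex)"
      by (simp only: norm_mult powr_minus norm_divide norm_one inverse_eq_divide mult_1)
    also have "\<dots> \<le> 1 / (real m)\<^sup>2"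
      using m assms by (intro frac_le norm_of_nat_powr_ge) auto
    finally show "norm (exp (2 * of_real pi * \<i> * of_nat m * of_real \<alpha>) * of_nat m powr (- z)) \<le> 1 / (real m)\<^sup>2" .
  qed
  then show ?thesis unfolding lerch_series_def by (rule has_sum_infsum)
qed

text \<open>The index set splits according to the signs of \<open>m = 3 * k - l\<close> and
  \<open>l - m\<close>. A negative \<open>m\<close> produces \<open>(- 1) ^ p\<close>, a negative
  \<open>l - m\<close> produces \<open>(- 1) ^ q\<close>, and in each range the largest of the three
  absolute values is the sum of the other two.\<close>

lemma PU3_rearrangement:
  fixes p q :: nat and s :: complex
  assumes p: "1 \<le> p" and q: "1 \<le> q" and s: "2 < Re s"
  defines "f \<equiv> \<lambda>(l::nat, k::int). of_nat l powr (- s) * (1 / (of_int (3 * k - int l) ^ p * of_int (2 * int l - 3 * k) ^ q))"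
  shows "(f has_sum (zeta2_PU3_series (vector [of_nat p, of_nat q, s])
      + (- 1) ^ p * zeta2_PU3_series (vector [of_nat p, s, of_nat q])
      + (- 1) ^ q * zeta2_PU3_series (vector [of_nat q, s, of_nat p]))) ({1..} \<times> UNIV)"
proof -
  have 3: "3 * ((2 * int m + int n) div 3) = 2 * int m + int n" "3 * ((int n - int m) div 3) = int n - int m"
      "3 * ((int m + 2 * int n) div 3) = int m + 2 * int n"
    if "m mod 3 = n mod 3" for m n :: nat
    using that by presburger+
  have neg: "(- of_nat k) ^ j = (- 1) ^ j * (of_nat k ^ j :: complex)" for k j
    by (rule power_minus)
  have inv: "1 / ((- 1) ^ j * y) = (- 1) ^ j * (1 / y)" for y :: complex and j
    by (cases "even j") auto
  have pw: "of_nat k powr of_nat j = (of_nat k ^ j :: complex)" if "1 \<le> j" for k j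
    using that by (simp add: powr_nat')
  have alg: "x powr (- s) * (1 / (a * b)) = 1 / (a * b * x powr s)"
      "x powr (- s) * (c * (1 / (a * b))) = c * (1 / (a * x powr s * b))"
      "x powr (- s) * (c * (1 / (a * b))) = c * (1 / (b * x powr s * a))" for x a b c :: complex
    by (simp_all add: powr_minus inverse_eq_divide mult_ac)
  define J1 where "J1 = {(l::nat, k). 1 \<le> l \<and> 0 < 3 * k - int l \<and> 3 * k - int l < int l}"
  define J2 where "J2 = {(l::nat, k). 1 \<le> l \<and> 3 * k - int l < 0}"
  define J3 where "J3 = {(l::nat, k). 1 \<le> l \<and> int l < 3 * k - int l}"
  have "(f has_sum zeta2_PU3_series (vector [of_nat p, of_nat q, s])) J1"
    unfolding J1_def has_sum_reindex_bij_betw[OF bij_betw_PU3_index(1), symmetric]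
  proof (subst has_sum_cong)
    fix x assume "x \<in> PU3_index"
    then obtain m n where x: "x = (m, n)" "1 \<le> m" "1 \<le> n" "m mod 3 = n mod 3" by (auto simp: PU3_index_def)
    have "3 * ((2 * int m + int n) div 3) - int (m + n) = int m"
      "2 * int (m + n) - 3 * ((2 * int m + int n) div 3) = int n"
      unfolding 3[OF x(4)] by auto
    then have "f (m + n, (2 * int m + int n) div 3) = of_nat (m + n) powr (- s) * (1 / (of_nat m ^ p * of_nat n ^ q))"
      by (simp only: f_def prod.case of_int_of_nat_eq)
    also have "\<dots> = PU3_term (vector [of_nat p, of_nat q, s]) (m, n)"
      unfolding PU3_term_def prod.case vector_3 pw[OF p] pw[OF q] by (rule alg)
    finally show "f (case x of (m, n) \<Rightarrow> (m + n, (2 * int m + int n) div 3)) = PU3_term (vector [of_nat p, of_nat q, s]) x"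
      by (simp add: x)
  qed (intro zeta2_PU3_series_has_sum PU3_convergence_last p q s)
  moreover have "(f has_sum (- 1) ^ p * zeta2_PU3_series (vector [of_nat p, s, of_nat q])) J2"
    unfolding J2_def has_sum_reindex_bij_betw[OF bij_betw_PU3_index(2), symmetric]
  proof (subst has_sum_cong)
    fix x assume "x \<in> PU3_index"
    then obtain m n where x: "x = (m, n)" "1 \<le> m" "1 \<le> n" "m mod 3 = n mod 3" by (auto simp: PU3_index_def)
    have "3 * ((int n - int m) div 3) - int n = - int m"
      "2 * int n - 3 * ((int n - int m) div 3) = int (m + n)"
      unfolding 3[OF x(4)] by auto
    then have "f (n, (int n - int m) div 3) = of_nat n powr (- s) * (1 / ((- 1) ^ p * (of_nat m ^ p * of_nat (m + n) ^ q)))"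
      by (simp only: f_def prod.case of_int_of_nat_eq of_int_minus neg mult.assoc)
    also have "\<dots> = (- 1) ^ p * PU3_term (vector [of_nat p, s, of_nat q]) (m, n)"
      unfolding PU3_term_def prod.case vector_3 inv pw[OF p] pw[OF q] by (rule alg)
    finally show "f (case x of (m, n) \<Rightarrow> (n, (int n - int m) div 3)) = (- 1) ^ p * PU3_term (vector [of_nat p, s, of_nat q]) x"
      by (simp add: x)
  qed (intro has_sum_cmult_right zeta2_PU3_series_has_sum PU3_convergence_middle p q s)
  moreover have "(f has_sum (- 1) ^ q * zeta2_PU3_series (vector [of_nat q, s, of_nat p])) J3"
    unfolding J3_def has_sum_reindex_bij_betw[OF bij_betw_PU3_index(3), symmetric]
  proof (subst has_sum_cong)
    fix x assume "x \<in> PU3_index"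
    then obtain m n where x: "x = (m, n)" "1 \<le> m" "1 \<le> n" "m mod 3 = n mod 3" by (auto simp: PU3_index_def)
    have "3 * ((int m + 2 * int n) div 3) - int n = int (m + n)"
      "2 * int n - 3 * ((int m + 2 * int n) div 3) = - int m"
      unfolding 3[OF x(4)] by auto
    then have "f (n, (int m + 2 * int n) div 3) = of_nat n powr (- s) * (1 / ((- 1) ^ q * (of_nat (m + n) ^ p * of_nat m ^ q)))"
      by (simp only: f_def prod.case of_int_of_nat_eq of_int_minus neg mult_ac)
    also have "\<dots> = (- 1) ^ q * PU3_term (vector [of_nat q, s, of_nat p]) (m, n)"
      unfolding PU3_term_def prod.case vector_3 inv pw[OF p] pw[OF q] by (rule alg)
    finally show "f (case x of (m, n) \<Rightarrow> (n, (int m + 2 * int n) div 3)) = (- 1) ^ q * PU3_term (vector [of_nat q, s, of_nat p]) x"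
      by (simp add: x)
  qed (intro has_sum_cmult_right zeta2_PU3_series_has_sum PU3_convergence_middle p q s)
  ultimately have "(f has_sum (zeta2_PU3_series (vector [of_nat p, of_nat q, s])
      + (- 1) ^ p * zeta2_PU3_series (vector [of_nat p, s, of_nat q])
      + (- 1) ^ q * zeta2_PU3_series (vector [of_nat q, s, of_nat p]))) (J1 \<union> J2 \<union> J3)"
    by (intro has_sum_Un_disjoint) (auto simp: J1_def J2_def J3_def)
  then show ?thesis
  proof (subst has_sum_cong_neutral[where S = "J1 \<union> J2 \<union> J3" and g = f, symmetric])
    \<comment> \<open>The indices left over have \<open>m = 0\<close> or \<open>m = l\<close>. As
      \<open>p\<close> and \<open>q\<close> are positive, the denominator is 0 there and the term is
      0 by convention.\<close>
    fix x assume "x \<in> {1..} \<times> UNIV - (J1 \<union> J2 \<union> J3)"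
    then obtain l k where x: "x = (l, k)" "1 \<le> l" "3 * k - int l = 0 \<or> 3 * k - int l = int l"
      by (fastforce simp: J1_def J2_def J3_def)
    then consider "3 * k - int l = 0" | "2 * int l - 3 * k = 0" by linarith
    then show "f x = 0"
      by cases (use p q in \<open>simp_all only: f_def x prod.case of_int_0, auto simp: power_0_left\<close>)
  qed (auto simp: J1_def J2_def J3_def)
qed

section \<open>Passage to Lerch series\<close>

text \<open>The powers of \<open>l\<close> combine into the exponent of a Lerch series, and the
  roots of unity in the twist become its phases. The twist at \<open>2 * l\<close>, congruent to
  \<open>- l\<close> modulo 3, gives the opposite phase. The value used for \<open>r\<close> is
  \<open>p + q\<close>.\<close>

lemma bernoulli_twist_times_powr:
  assumes l: "1 \<le> l" and \<tau>: "\<tau> \<le> r"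
  shows "of_nat l powr (- s) * (1 / of_nat l) ^ (r - \<tau>) * bernoulli_twist \<tau> (int l) =
      (2 * of_real pi * \<i>) ^ \<tau> / fact \<tau> * (\<Sum>a = 0..2. bernoulli_poly \<tau> (of_nat a / 3) *
        (exp (2 * of_real pi * \<i> * of_nat l * of_real (- (real a / 3))) * of_nat l powr (- (s + of_nat r - of_nat \<tau>))))"
    and "of_nat l powr (- s) * (1 / of_nat l) ^ (r - \<tau>) * bernoulli_twist \<tau> (2 * int l) =
      (2 * of_real pi * \<i>) ^ \<tau> / fact \<tau> * (\<Sum>a = 0..2. bernoulli_poly \<tau> (of_nat a / 3) *
        (exp (2 * of_real pi * \<i> * of_nat l * of_real (real a / 3)) * of_nat l powr (- (s + of_nat r - of_nat \<tau>))))"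
proof -
  have powr: "of_nat l powr (- s) * (1 / of_nat l) ^ (r - \<tau>) = of_nat l powr (- (s + of_nat r - of_nat \<tau>))"
  proof -
    have "- (s + of_nat r - of_nat \<tau>) = - s - of_nat (r - \<tau>)"
      using \<tau> by (simp add: of_nat_diff)
    then show ?thesis using l by (simp only: powr_diff) (simp add: powr_nat' power_one_over)
  qed
  have e1: "exp (- (2 * of_real pi * \<i> * of_nat a * of_int (int l) / 3)) =
      exp (2 * of_real pi * \<i> * of_nat l * of_real (- (real a / 3)))" for a
    by (simp add: mult_ac)
  have e2: "exp (- (2 * of_real pi * \<i> * of_nat a * of_int (2 * int l) / 3)) =
      exp (2 * of_real pi * \<i> * of_nat l * of_real (real a / 3))" for a
  proof -
    have "- (2 * of_real pi * \<i> * of_nat a * of_int (2 * int l) / 3) =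
      2 * of_real pi * \<i> * of_nat l * of_real (real a / 3) + of_int (2 * (- int (a * l))) * (of_real pi * \<i>)"
      by (simp add: field_simps)
    also have "exp \<dots> = exp (2 * of_real pi * \<i> * of_nat l * of_real (real a / 3)) *
        exp (of_int (2 * (- int (a * l))) * (of_real pi * \<i>))"
      by (rule exp_add)
    also have "exp (of_int (2 * (- int (a * l))) * (of_real pi * \<i>)) = (1::complex)"
      by (subst exp_eq_1) (auto intro!: exI[of _ "- int (a * l)"])
    finally show ?thesis by simp
  qed
  show "of_nat l powr (- s) * (1 / of_nat l) ^ (r - \<tau>) * bernoulli_twist \<tau> (int l) =
      (2 * of_real pi * \<i>) ^ \<tau> / fact \<tau> * (\<Sum>a = 0..2. bernoulli_poly \<tau> (of_nat a / 3) *
        (exp (2 * of_real pi * \<i> * of_nat l * of_real (- (real a / 3))) * of_nat l powr (- (s + of_nat r - of_nat \<tau>))))"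
    unfolding powr bernoulli_twist_def e1 by (simp only: sum_distrib_left mult_ac)
  show "of_nat l powr (- s) * (1 / of_nat l) ^ (r - \<tau>) * bernoulli_twist \<tau> (2 * int l) =
      (2 * of_real pi * \<i>) ^ \<tau> / fact \<tau> * (\<Sum>a = 0..2. bernoulli_poly \<tau> (of_nat a / 3) *
        (exp (2 * of_real pi * \<i> * of_nat l * of_real (real a / 3)) * of_nat l powr (- (s + of_nat r - of_nat \<tau>))))"
    unfolding powr bernoulli_twist_def e2 by (simp only: sum_distrib_left mult_ac)
qed

lemma zeta2_PU3_series_functional_relation:
  fixes p q :: nat and s :: complex
  assumes p: "1 \<le> p" and q: "1 \<le> q" and s: "2 < Re s"
  shows
    "3 * (zeta2_PU3_series (vector [of_nat p, of_nat q, s])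
          + (- 1) ^ p * zeta2_PU3_series (vector [of_nat p, s, of_nat q])
          + (- 1) ^ q * zeta2_PU3_series (vector [of_nat q, s, of_nat p]))
     = - (\<Sum>\<tau> = 0..p. of_nat ((p + q - \<tau> - 1) choose (q - 1)) * (- 1) ^ \<tau>
             * ((2 * of_real pi * \<i>) ^ \<tau> / fact \<tau>)
             * (\<Sum>a = 0..2. bernoulli_poly \<tau> (of_nat a / 3)
                  * lerch_series (s + of_nat p + of_nat q - of_nat \<tau>) (- (real a / 3))))
       - (\<Sum>\<tau> = 0..q. of_nat ((p + q - \<tau> - 1) choose (p - 1))
             * ((2 * of_real pi * \<i>) ^ \<tau> / fact \<tau>)
             * (\<Sum>a = 0..2. bernoulli_poly \<tau> (of_nat a / 3)
                  * lerch_series (s + of_nat p + of_nat q - of_nat \<tau>) (real a / 3)))"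
    (is "3 * ?Z = - ?A - ?B")
proof -
  define g where "g = (\<lambda>(l::nat) (k::int). 1 / (of_int (3 * k - int l) ^ p * of_int (2 * int l - 3 * k) ^ q) :: complex)"
  define W where "W = (\<lambda>l. \<Sum>\<^sub>\<infinity>k. g l k)"
  have Z: "((\<lambda>(l, k). of_nat l powr (- s) * g l k) has_sum ?Z) ({1..} \<times> UNIV)"
    using PU3_rearrangement[OF p q s] by (simp only: g_def)
  \<comment> \<open>Convergence over \<open>k\<close> is inherited from the double sum, since the
    factor \<open>l powr (- s)\<close> is nonzero.\<close>
  have gW: "(g l has_sum W l) UNIV" if "1 \<le> l" for l
  proof -
    have "(\<lambda>(l, k). of_nat l powr (- s) * g l k) summable_on {1..} \<times> UNIV"
      using Z by (rule has_sum_imp_summable)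
    then have "(\<lambda>k. of_nat l powr (- s) * g l k) summable_on UNIV"
      using that by (intro summable_on_SigmaD1[where f = "\<lambda>l k. of_nat l powr (- s) * g l k"]) auto
    then have "g l summable_on UNIV"
      using that by (subst (asm) summable_on_cmult_right') auto
    then show ?thesis unfolding W_def by (rule has_sum_infsum)
  qed
  have "((\<lambda>l. of_nat l powr (- s) * W l) has_sum ?Z) {1..}"
    using Z by (rule has_sum_SigmaD) (auto intro!: has_sum_cmult_right gW)
  then have "((\<lambda>l. 3 * (of_nat l powr (- s) * W l)) has_sum (3 * ?Z)) {1..}"
    by (rule has_sum_cmult_right)
  moreover have "((\<lambda>l. 3 * (of_nat l powr (- s) * W l)) has_sum (- ?A - ?B)) {1..}"
  proof -
    define e where "e = (\<lambda>\<tau> \<alpha> l. exp (2 * of_real pi * \<i> * of_nat l * of_real \<alpha>) *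
       of_nat l powr (- (s + of_nat p + of_nat q - of_nat \<tau>)))"
    \<comment> \<open>For \<open>\<tau> \<le> p + q\<close> the argument keeps a real part above 2,
      so every Lerch series involved converges absolutely.\<close>
    have lerch: "(e \<tau> \<alpha> has_sum lerch_series (s + of_nat p + of_nat q - of_nat \<tau>) \<alpha>) {1..}"
      if "\<tau> \<le> p + q" for \<tau> \<alpha>
    proof -
      have "real \<tau> \<le> real p + real q" using that by linarith
      then show ?thesis unfolding e_def using s by (intro lerch_series_has_sum) simp
    qed
    have inner: "((\<lambda>l. \<Sum>a = 0..2. bernoulli_poly \<tau> (of_nat a / 3) * e \<tau> (\<alpha> a) l) has_sum
        (\<Sum>a = 0..2. bernoulli_poly \<tau> (of_nat a / 3) * lerch_series (s + of_nat p + of_nat q - of_nat \<tau>) (\<alpha> a))) {1..}"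
      if "\<tau> \<le> p + q" for \<tau> and \<alpha> :: "nat \<Rightarrow> real"
      by (rule has_sum_finite_sum, rule has_sum_cmult_right, rule lerch[OF that])
    have "((\<lambda>l. - (\<Sum>\<tau> = 0..p. of_nat ((p + q - \<tau> - 1) choose (q - 1)) * (- 1) ^ \<tau>
             * ((2 * of_real pi * \<i>) ^ \<tau> / fact \<tau>)
             * (\<Sum>a = 0..2. bernoulli_poly \<tau> (of_nat a / 3) * e \<tau> (- (real a / 3)) l))
       + - (\<Sum>\<tau> = 0..q. of_nat ((p + q - \<tau> - 1) choose (p - 1))
             * ((2 * of_real pi * \<i>) ^ \<tau> / fact \<tau>)
             * (\<Sum>a = 0..2. bernoulli_poly \<tau> (of_nat a / 3) * e \<tau> (real a / 3) l))) has_sum (- ?A + - ?B)) {1..}"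
      by (intro has_sum_add has_sum_uminusI has_sum_finite_sum[where I = "{0.._}"] has_sum_cmult_right inner) auto
    moreover have "3 * (of_nat l powr (- s) * W l) = - (\<Sum>\<tau> = 0..p. of_nat ((p + q - \<tau> - 1) choose (q - 1)) * (- 1) ^ \<tau>
             * ((2 * of_real pi * \<i>) ^ \<tau> / fact \<tau>)
             * (\<Sum>a = 0..2. bernoulli_poly \<tau> (of_nat a / 3) * e \<tau> (- (real a / 3)) l))
       + - (\<Sum>\<tau> = 0..q. of_nat ((p + q - \<tau> - 1) choose (p - 1))
             * ((2 * of_real pi * \<i>) ^ \<tau> / fact \<tau>)
             * (\<Sum>a = 0..2. bernoulli_poly \<tau> (of_nat a / 3) * e \<tau> (real a / 3) l))" if "l \<in> {1..}" for l
    proof -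
      have l: "1 \<le> l" using that by simp
      have "3 * (of_nat l powr (- s) * W l) = of_nat l powr (- s) * (3 * W l)" by simp
      also have "3 * W l = - (\<Sum>\<tau> = 0..p. of_nat ((p + q - \<tau> - 1) choose (q - 1)) * (1 / of_nat l) ^ (p + q - \<tau>)
          * ((- 1) ^ \<tau> * bernoulli_twist \<tau> (int l)))
        - (\<Sum>\<tau> = 0..q. of_nat ((p + q - \<tau> - 1) choose (p - 1)) * (1 / of_nat l) ^ (p + q - \<tau>)
          * bernoulli_twist \<tau> (2 * int l))"
        using gW[OF l] unfolding g_def by (rule progression_product_sum[OF l p q])
      also have "of_nat l powr (- s) * \<dots> =
         - (\<Sum>\<tau> = 0..p. of_nat ((p + q - \<tau> - 1) choose (q - 1)) * (- 1) ^ \<tau> *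
             (of_nat l powr (- s) * (1 / of_nat l) ^ (p + q - \<tau>) * bernoulli_twist \<tau> (int l)))
         + - (\<Sum>\<tau> = 0..q. of_nat ((p + q - \<tau> - 1) choose (p - 1)) *
             (of_nat l powr (- s) * (1 / of_nat l) ^ (p + q - \<tau>) * bernoulli_twist \<tau> (2 * int l)))"
        by (simp only: distrib_left mult_minus_right sum_distrib_left diff_conv_add_uminus mult_ac)
      also have "(\<Sum>\<tau> = 0..p. of_nat ((p + q - \<tau> - 1) choose (q - 1)) * (- 1) ^ \<tau> *
             (of_nat l powr (- s) * (1 / of_nat l) ^ (p + q - \<tau>) * bernoulli_twist \<tau> (int l))) =
          (\<Sum>\<tau> = 0..p. of_nat ((p + q - \<tau> - 1) choose (q - 1)) * (- 1) ^ \<tau>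
             * ((2 * of_real pi * \<i>) ^ \<tau> / fact \<tau>)
             * (\<Sum>a = 0..2. bernoulli_poly \<tau> (of_nat a / 3) * e \<tau> (- (real a / 3)) l))"
      proof (intro sum.cong refl)
        fix \<tau> assume "\<tau> \<in> {0..p}"
        then have "\<tau> \<le> p + q" by simp
        then show "of_nat ((p + q - \<tau> - 1) choose (q - 1)) * (- 1) ^ \<tau> *
             (of_nat l powr (- s) * (1 / of_nat l) ^ (p + q - \<tau>) * bernoulli_twist \<tau> (int l)) =
           of_nat ((p + q - \<tau> - 1) choose (q - 1)) * (- 1) ^ \<tau>
             * ((2 * of_real pi * \<i>) ^ \<tau> / fact \<tau>)
             * (\<Sum>a = 0..2. bernoulli_poly \<tau> (of_nat a / 3) * e \<tau> (- (real a / 3)) l)"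
          unfolding bernoulli_twist_times_powr(1)[OF l \<open>\<tau> \<le> p + q\<close>] e_def of_nat_add
          by (simp only: mult.assoc add.assoc)
      qed
      also have "(\<Sum>\<tau> = 0..q. of_nat ((p + q - \<tau> - 1) choose (p - 1)) *
             (of_nat l powr (- s) * (1 / of_nat l) ^ (p + q - \<tau>) * bernoulli_twist \<tau> (2 * int l))) =
          (\<Sum>\<tau> = 0..q. of_nat ((p + q - \<tau> - 1) choose (p - 1))
             * ((2 * of_real pi * \<i>) ^ \<tau> / fact \<tau>)
             * (\<Sum>a = 0..2. bernoulli_poly \<tau> (of_nat a / 3) * e \<tau> (real a / 3) l))"
      proof (intro sum.cong refl)
        fix \<tau> assume "\<tau> \<in> {0..q}"
        then have "\<tau> \<le> p + q" by simp
        then show "of_nat ((p + q - \<tau> - 1) choose (p - 1)) *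
             (of_nat l powr (- s) * (1 / of_nat l) ^ (p + q - \<tau>) * bernoulli_twist \<tau> (2 * int l)) =
           of_nat ((p + q - \<tau> - 1) choose (p - 1))
             * ((2 * of_real pi * \<i>) ^ \<tau> / fact \<tau>)
             * (\<Sum>a = 0..2. bernoulli_poly \<tau> (of_nat a / 3) * e \<tau> (real a / 3) l)"
          unfolding bernoulli_twist_times_powr(2)[OF l \<open>\<tau> \<le> p + q\<close>] e_def of_nat_add
          by (simp only: mult.assoc add.assoc)
      qed
      finally show ?thesis .
    qed
    ultimately show ?thesis by (subst has_sum_cong) simp_all
  qed
  ultimately show ?thesis by (rule has_sum_unique)
qed

section \<open>Continuation of the relation\<close>

theorem theorem5p1:
  fixes p q :: nat and s :: complex
  assumes "1 \<le> p" and "1 \<le> q"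
    and "vector [of_nat p, of_nat q, s] \<notin> zeta2_PU3_singularities"
    and "vector [of_nat p, s, of_nat q] \<notin> zeta2_PU3_singularities"
    and "vector [of_nat q, s, of_nat p] \<notin> zeta2_PU3_singularities"
    and "\<And>\<tau> a. \<tau> \<le> p \<Longrightarrow> a \<le> 2 \<Longrightarrow>
           s + of_nat p + of_nat q - of_nat \<tau> \<notin> lerch_singularities (- (real a / 3))"
    and "\<And>\<tau> a. \<tau> \<le> q \<Longrightarrow> a \<le> 2 \<Longrightarrow>
           s + of_nat p + of_nat q - of_nat \<tau> \<notin> lerch_singularities (real a / 3)"
  shows
    "3 * (zeta2_PU3 (vector [of_nat p, of_nat q, s])
          + (- 1) ^ p * zeta2_PU3 (vector [of_nat p, s, of_nat q])
          + (- 1) ^ q * zeta2_PU3 (vector [of_nat q, s, of_nat p]))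
     = - (\<Sum>\<tau> = 0..p. of_nat ((p + q - \<tau> - 1) choose (q - 1)) * (- 1) ^ \<tau>
             * ((2 * of_real pi * \<i>) ^ \<tau> / fact \<tau>)
             * (\<Sum>a = 0..2. bernoulli_poly \<tau> (of_nat a / 3)
                  * lerch_phi (s + of_nat p + of_nat q - of_nat \<tau>) (- (real a / 3))))
       - (\<Sum>\<tau> = 0..q. of_nat ((p + q - \<tau> - 1) choose (p - 1))
             * ((2 * of_real pi * \<i>) ^ \<tau> / fact \<tau>)
             * (\<Sum>a = 0..2. bernoulli_poly \<tau> (of_nat a / 3)
                  * lerch_phi (s + of_nat p + of_nat q - of_nat \<tau>) (real a / 3)))"
proof -
  note p = assms(1) and q = assms(2)
  \<comment> \<open>The point 3 serves as a base point inside the half-plane where the relation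
    between the series is known.\<close>
  have Re_gt: "eventually (\<lambda>t. 2 < Re t) (at 3)"
    using eventually_at_in_open'[OF open_halfspace_Re_gt[of 2], of 3] by simp
  have "eventually (\<lambda>t. vector [of_nat p, of_nat q, t] \<in> zeta2_PU3_convergence) (at 3)"
    using Re_gt by eventually_elim (rule PU3_convergence_last[OF p q])
  then obtain G1 where G1: "G1 meromorphic_on UNIV" "G1 analytic_on {s}"
    "eventually (\<lambda>t. G1 t = zeta2_PU3_series (vector [of_nat p, of_nat q, t])) (at 3)"
    "zeta2_PU3 (vector [of_nat p, of_nat q, s]) = G1 s"
    using assms(3) unfolding zeta2_PU3_def zeta2_PU3_singularities_def
    by (rule meromorphic_continuation_Cn_line_value[OF has_derivative_vector_3(1)])
  have "eventually (\<lambda>t. vector [of_nat p, t, of_nat q] \<in> zeta2_PU3_convergence) (at 3)"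
    using Re_gt by eventually_elim (rule PU3_convergence_middle[OF p q])
  then obtain G2 where G2: "G2 meromorphic_on UNIV" "G2 analytic_on {s}"
    "eventually (\<lambda>t. G2 t = zeta2_PU3_series (vector [of_nat p, t, of_nat q])) (at 3)"
    "zeta2_PU3 (vector [of_nat p, s, of_nat q]) = G2 s"
    using assms(4) unfolding zeta2_PU3_def zeta2_PU3_singularities_def
    by (rule meromorphic_continuation_Cn_line_value[OF has_derivative_vector_3(2)])
  have "eventually (\<lambda>t. vector [of_nat q, t, of_nat p] \<in> zeta2_PU3_convergence) (at 3)"
    using Re_gt by eventually_elim (rule PU3_convergence_middle[OF q p])
  then obtain G3 where G3: "G3 meromorphic_on UNIV" "G3 analytic_on {s}"
    "eventually (\<lambda>t. G3 t = zeta2_PU3_series (vector [of_nat q, t, of_nat p])) (at 3)"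
    "zeta2_PU3 (vector [of_nat q, s, of_nat p]) = G3 s"
    using assms(5) unfolding zeta2_PU3_def zeta2_PU3_singularities_def
    by (rule meromorphic_continuation_Cn_line_value[OF has_derivative_vector_3(2)])
  define u where "u = (\<lambda>\<tau> t. t + of_nat p + of_nat q - complex_of_nat \<tau>)"
  have u: "u \<tau> analytic_on A" for \<tau> A
    unfolding u_def by (intro analytic_intros)
  have Re_u: "1 < Re (u \<tau> t)" if "\<tau> \<le> p + q" "2 < Re t" for \<tau> t
  proof -
    have "real \<tau> \<le> real p + real q" using that(1) by linarith
    then show ?thesis using that(2) by (simp add: u_def)
  qed
  define P where "P = (\<lambda>F \<tau> \<alpha>. F meromorphic_on UNIV \<and> F analytic_on {u \<tau> s} \<and>
      (\<forall>z. 1 < Re z \<longrightarrow> F z = lerch_series z \<alpha>) \<and> lerch_phi (u \<tau> s) \<alpha> = F (u \<tau> s))"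
  have P: "\<exists>F. P F \<tau> \<alpha>" if "u \<tau> s \<notin> lerch_singularities \<alpha>" for \<tau> \<alpha>
    using lerch_phi_continuation[OF that] unfolding P_def by metis
  \<comment> \<open>The continuation is chosen separately for each \<open>\<tau>\<close> and
    \<open>a\<close>, since analyticity is required at the point \<open>u \<tau> s\<close>, which
    moves with \<open>\<tau>\<close>.\<close>
  have "\<forall>\<tau> a. \<exists>F. \<tau> \<le> p \<longrightarrow> a \<le> 2 \<longrightarrow> P F \<tau> (- (real a / 3))"
    using P assms(6) unfolding u_def by blast
  then obtain \<Phi> where \<Phi>: "\<And>\<tau> a. \<tau> \<le> p \<Longrightarrow> a \<le> 2 \<Longrightarrow> P (\<Phi> \<tau> a) \<tau> (- (real a / 3))"
    by metis
  have "\<forall>\<tau> a. \<exists>F. \<tau> \<le> q \<longrightarrow> a \<le> 2 \<longrightarrow> P F \<tau> (real a / 3)"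
    using P assms(7) unfolding u_def by blast
  then obtain \<Psi> where \<Psi>: "\<And>\<tau> a. \<tau> \<le> q \<Longrightarrow> a \<le> 2 \<Longrightarrow> P (\<Psi> \<tau> a) \<tau> (real a / 3)"
    by metis
  define L where "L = (\<lambda>t. 3 * (G1 t + (- 1) ^ p * G2 t + (- 1) ^ q * G3 t))"
  define R where "R = (\<lambda>\<phi> \<psi>.
       - (\<Sum>\<tau> = 0..p. of_nat ((p + q - \<tau> - 1) choose (q - 1)) * (- 1) ^ \<tau>
             * ((2 * of_real pi * \<i>) ^ \<tau> / fact \<tau>)
             * (\<Sum>a = 0..2. bernoulli_poly \<tau> (of_nat a / 3) * \<phi> \<tau> a))
       - (\<Sum>\<tau> = 0..q. of_nat ((p + q - \<tau> - 1) choose (p - 1))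
             * ((2 * of_real pi * \<i>) ^ \<tau> / fact \<tau>)
             * (\<Sum>a = 0..2. bernoulli_poly \<tau> (of_nat a / 3) * \<psi> \<tau> a)))"
  have R_cong: "R \<phi> \<psi> = R \<phi>' \<psi>'"
    if "\<And>\<tau> a. \<tau> \<le> p \<Longrightarrow> a \<le> 2 \<Longrightarrow> \<phi> \<tau> a = \<phi>' \<tau> a"
      "\<And>\<tau> a. \<tau> \<le> q \<Longrightarrow> a \<le> 2 \<Longrightarrow> \<psi> \<tau> a = \<psi>' \<tau> a" for \<phi> \<phi>' \<psi> \<psi>'
    unfolding R_def using that
    by (intro arg_cong2[of _ _ _ _ "(-)"] arg_cong[of _ _ uminus] sum.cong arg_cong2[of _ _ _ _ "(*)"]) auto
  \<comment> \<open>\<open>H\<close> is meromorphic in the plane, analytic at \<open>s\<close> and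
    zero near 3, so the identity theorem yields the relation at \<open>s\<close>.\<close>
  define H where "H = (\<lambda>t. L t - R (\<lambda>\<tau> a. \<Phi> \<tau> a (u \<tau> t)) (\<lambda>\<tau> a. \<Psi> \<tau> a (u \<tau> t)))"
  have "H s = 0"
  proof (rule meromorphic_on_UNIV_eq_0[where f = H and s = s])
    have "(\<lambda>t. \<Phi> \<tau> a (u \<tau> t)) meromorphic_on UNIV" if "\<tau> \<in> {0..p}" "a \<in> {0..2}" for \<tau> a
      using \<Phi>[of \<tau> a] that unfolding P_def by (intro meromorphic_on_compose[OF _ u]) auto
    moreover have "(\<lambda>t. \<Psi> \<tau> a (u \<tau> t)) meromorphic_on UNIV" if "\<tau> \<in> {0..q}" "a \<in> {0..2}" for \<tau> a
      using \<Psi>[of \<tau> a] that unfolding P_def by (intro meromorphic_on_compose[OF _ u]) auto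
    ultimately show "H meromorphic_on UNIV"
      unfolding H_def L_def R_def using G1(1) G2(1) G3(1) by (intro meromorphic_intros)
    have "(\<lambda>t. \<Phi> \<tau> a (u \<tau> t)) analytic_on {s}" if "\<tau> \<in> {0..p}" "a \<in> {0..2}" for \<tau> a
      using \<Phi>[of \<tau> a] that unfolding P_def
      by (intro analytic_on_compose[OF u, unfolded o_def]) auto
    moreover have "(\<lambda>t. \<Psi> \<tau> a (u \<tau> t)) analytic_on {s}" if "\<tau> \<in> {0..q}" "a \<in> {0..2}" for \<tau> a
      using \<Psi>[of \<tau> a] that unfolding P_def
      by (intro analytic_on_compose[OF u, unfolded o_def]) auto
    ultimately show "H analytic_on {s}"
      unfolding H_def L_def R_def using G1(2) G2(2) G3(2) by (intro analytic_intros)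
    show "eventually (\<lambda>t. H t = 0) (at 3)"
      using Re_gt G1(3) G2(3) G3(3)
    proof eventually_elim
      case (elim t)
      have "L t = R (\<lambda>\<tau> a. lerch_series (u \<tau> t) (- (real a / 3))) (\<lambda>\<tau> a. lerch_series (u \<tau> t) (real a / 3))"
        unfolding L_def R_def u_def elim(2-4) by (rule zeta2_PU3_series_functional_relation[OF p q elim(1)])
      also have "\<dots> = R (\<lambda>\<tau> a. \<Phi> \<tau> a (u \<tau> t)) (\<lambda>\<tau> a. \<Psi> \<tau> a (u \<tau> t))"
        using \<Phi> \<Psi> Re_u[OF _ elim(1)] unfolding P_def by (intro R_cong) auto
      finally show ?case by (simp add: H_def)
    qed
  qed
  then have "L s = R (\<lambda>\<tau> a. \<Phi> \<tau> a (u \<tau> s)) (\<lambda>\<tau> a. \<Psi> \<tau> a (u \<tau> s))" by (simp add: H_def)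
  also have "\<dots> = R (\<lambda>\<tau> a. lerch_phi (u \<tau> s) (- (real a / 3))) (\<lambda>\<tau> a. lerch_phi (u \<tau> s) (real a / 3))"
    using \<Phi> \<Psi> unfolding P_def by (intro R_cong) auto
  finally show ?thesis
    unfolding L_def R_def u_def G1(4) G2(4) G3(4) .
qed

end
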